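(* For $\rho\in(-1,1)$ let $C(\rho)=\begin{pmatrix}1&\rho\\\rho&1\end{pmatrix}$. Let $C_1=C(\rho_1),C_2=C(\rho_2)\in\mathrm{Cor}^+(2)$ with $\rho_1,\rho_2\in(-1,1)$. 1. On $\mathrm{Cor}^+(2)$, quotient-affine metrics and poly-hyperbolic-Cholesky metrics coincide (up to a scaling factor). The geodesic between $C_1$ (at $t=0$) and $C_2$ (at $t=1$) is $C(\rho(t))$ for $t\in\mathbb{R}$, where $$\rho(t)=\frac{\rho_1\cosh(\lambda t)+\sinh(\lambda t)}{\rho_1\sinh(\lambda t)+\cosh(\lambda t)},\qquad \lambda=\log\sqrt{\frac{1+\rho_2}{1-\rho_2}}-\log\sqrt{\frac{1+\rho_1}{1-\rho_1}}.$$ 2. On $\mathrm{Cor}^+(2)$, Euclidean-Cholesky and log-Euclidean-Cholesky metrics coincide. The geodesic between $C_1$ (at $t=0$) and $C_2$ (at $t=1$) is $C(\rho(t))$ for $t\in\mathbb{R}$, where $$\rho(t)=\frac{F(t)}{\sqrt{1+F(t)^2}},\qquad F(t)=(1-t)\frac{\rho_1}{\sqrt{1-\rho_1^2}}+t\frac{\rho_2}{\sqrt{1-\rho_2^2}}.$$ This geodesic also coincides with the Lie-Cholesky group geodesic between $C_1$ and $C_2$.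
   Context: $\mathrm{Cor}^+(n)$ is the manifold of real symmetric positive definite $n\times n$ matrices with unit diagonal; here $n=2$, so $\mathrm{Cor}^+(2)=\{C(\rho):\rho\in(-1,1)\}$, and tangent vectors are symmetric matrices with zero diagonal. $\mathrm{Diag}(M)$ is the diagonal matrix with the same diagonal as $M$. $\mathrm{Chol}(C)$ is the unique lower triangular $L$ with positive diagonal such that $C=LL^\top$. Quotient-affine metrics: $\alpha\,g^{\mathrm{QA}}$, $\alpha>0$, where $\alpha\,g^{\mathrm{QA}}$ is the quotient of the affine-invariant metric $g_\Sigma(V,V)=\alpha\,\mathrm{tr}(\Sigma^{-1}V\Sigma^{-1}V)+\beta\,\mathrm{tr}(\Sigma^{-1}V)^2$ ($\beta>-\alpha/n$; the quotient does not depend on $\beta$) on symmetric positive definite matrices by the submersion $\mathrm{cor}(\Sigma)=\mathrm{Diag}(\Sigma)^{-1/2}\Sigma\,\mathrm{Diag}(\Sigma)^{-1/2}$ onto $\mathrm{Cor}^+(n)$ (the metric making $\mathrm{cor}$ a Riemannian submersion). Explicitly $g^{\mathrm{QA}}_C(X,X)=\mathrm{tr}((C^{-1}X)^2)-2\,\mathbf{1}^\top\mathrm{Diag}(C^{-1}X)(I_n+C\bullet C^{-1})^{-1}\mathrm{Diag}(C^{-1}X)\mathbf{1}$, with $\bullet$ the entrywise product and $\mathbf{1}$ the all-ones vector. Poly-hyperbolic-Cholesky metrics for $n=2$: the second row $(L_{21},L_{22})$ of $L=\mathrm{Chol}(C)$ lies in the open half-circle $\mathrm{H}\mathbb{S}^1=\{x\in\mathbb{R}^2:\|x\|=1,x_2>0\}$,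 and $C\mapsto(L_{21},L_{22})$ is a diffeomorphism; the metric is the pullback by it of $\alpha_1g^{\mathrm{H}\mathbb{S}^1}$, $\alpha_1>0$, where $g^{\mathrm{H}\mathbb{S}^1}$ is the pullback of the metric induced by $Q(v)=v_1^2-v_2^2$ on the hyperboloid sheet $\{y\in\mathbb{R}^2:y_1^2-y_2^2=-1,y_2>0\}$ by $x\mapsto\frac1{x_2}(x_1,1)$. Let $\mathrm{LT}^0(2)$ be the strictly lower triangular $2\times2$ matrices and $\mathrm{LT}^1(2)=I_2+\mathrm{LT}^0(2)$, a Lie group for matrix multiplication. $\Theta:\mathrm{Cor}^+(2)\to\mathrm{LT}^1(2)$, $\Theta(C)=\mathrm{Diag}(\mathrm{Chol}(C))^{-1}\mathrm{Chol}(C)$, is a diffeomorphism. Given an inner product on $\mathrm{LT}^0(2)$, the Euclidean-Cholesky metric is its pullback by $\Theta$ (as a constant metric on the affine space $\mathrm{LT}^1(2)$), and the log-Euclidean-Cholesky metric is its pullback by $\log\circ\,\Theta$, where $\log:\mathrm{LT}^1(2)\to\mathrm{LT}^0(2)$ is the matrix logarithm; the two are compared for the same inner product. The Lie-Cholesky group geodesic between $C_1$ and $C_2$ is the geodesic for the Lie group structure on $\mathrm{Cor}^+(2)$ transported from $\mathrm{LT}^1(2)$ by $\Theta$ with its canonical Cartan-Schouten connection: $\gamma(t)=\Theta^{-1}\big(\Theta(C_1)\exp(t\log(\Theta(C_1)^{-1}\Theta(C_2)))\big)$. *)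

theory Defs
  imports "HOL-Analysis.Analysis"
begin

text \<open>
  Except for the half-circle and the hyperboloid sheet, which enter only through pullbacks,
  all manifolds below are subsets \<open>M\<close> of a Euclidean space which are relatively open in an
  affine subspace with direction space \<open>V\<close>, so that \<open>V\<close> is the tangent space of \<open>M\<close> at each of
  its points. A metric is a function \<open>g\<close> with \<open>g C X Y\<close> the product of the tangent vectors
  \<open>X, Y\<close> at \<open>C\<close>; only its values for \<open>C \<in> M\<close> and \<open>X, Y \<in> V\<close> matter.
\<close>

definition differential :: "('a::real_normed_vector \<Rightarrow> 'b::real_normed_vector) \<Rightarrow> 'a \<Rightarrow> 'a \<Rightarrow> 'b" where
  "differential f C X = vector_derivative (\<lambda>s. f (C + s *\<^sub>R X)) (at 0)"

definition metric_eq_on ::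
  "'a set \<Rightarrow> 'a set \<Rightarrow> ('a \<Rightarrow> 'a \<Rightarrow> 'a \<Rightarrow> real) \<Rightarrow> ('a \<Rightarrow> 'a \<Rightarrow> 'a \<Rightarrow> real) \<Rightarrow> bool" where
  "metric_eq_on M V g h \<longleftrightarrow> (\<forall>C\<in>M. \<forall>X\<in>V. \<forall>Y\<in>V. g C X Y = h C X Y)"

definition inner_product_on :: "'a::real_vector set \<Rightarrow> ('a \<Rightarrow> 'a \<Rightarrow> real) \<Rightarrow> bool" where
  "inner_product_on V b \<longleftrightarrow>
     (\<forall>X\<in>V. \<forall>Y\<in>V. b X Y = b Y X) \<and>
     (\<forall>X\<in>V. \<forall>Y\<in>V. \<forall>Z\<in>V. b (X + Y) Z = b X Z + b Y Z) \<and>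
     (\<forall>X\<in>V. \<forall>Y\<in>V. \<forall>r. b (r *\<^sub>R X) Y = r * b X Y) \<and>
     (\<forall>X\<in>V. X \<noteq> 0 \<longrightarrow> b X X > 0)"

definition pullback_metric ::
  "('a::real_normed_vector \<Rightarrow> 'b::real_normed_vector) \<Rightarrow> ('b \<Rightarrow> 'b \<Rightarrow> 'b \<Rightarrow> real)
     \<Rightarrow> 'a \<Rightarrow> 'a \<Rightarrow> 'a \<Rightarrow> real" where
  "pullback_metric f g C X Y = g (f C) (differential f C X) (differential f C Y)"

text \<open>
  Koszul's formula for constant vector fields: \<open>koszul g C X Y Z\<close> is the product of the
  Levi-Civita derivative of \<open>Y\<close> along \<open>X\<close> at \<open>C\<close> with \<open>Z\<close> (the brackets vanish).
\<close>

definition koszul ::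
  "('a::real_normed_vector \<Rightarrow> 'a \<Rightarrow> 'a \<Rightarrow> real) \<Rightarrow> 'a \<Rightarrow> 'a \<Rightarrow> 'a \<Rightarrow> 'a \<Rightarrow> real" where
  "koszul g C X Y Z =
     (differential (\<lambda>A. g A Y Z) C X + differential (\<lambda>A. g A X Z) C Y
      - differential (\<lambda>A. g A X Y) C Z) / 2"

text \<open>
  Levi-Civita geodesics defined on the whole real line: the covariant acceleration is
  orthogonal to all tangent vectors \<open>Z\<close>.
\<close>

definition geodesic ::
  "'a::real_normed_vector set \<Rightarrow> 'a set \<Rightarrow> ('a \<Rightarrow> 'a \<Rightarrow> 'a \<Rightarrow> real) \<Rightarrow> (real \<Rightarrow> 'a) \<Rightarrow> bool" where
  "geodesic M V g \<gamma> \<longleftrightarrow>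
     (\<forall>t. \<gamma> t \<in> M) \<and>
     (\<exists>v a. \<forall>t. (\<gamma> has_vector_derivative v t) (at t) \<and>
                (v has_vector_derivative a t) (at t) \<and>
                (\<forall>Z\<in>V. g (\<gamma> t) (a t) Z + koszul g (\<gamma> t) (v t) (v t) Z = 0))"

definition horizontal ::
  "('a::real_normed_vector \<Rightarrow> 'b::real_normed_vector) \<Rightarrow> 'a set \<Rightarrow> ('a \<Rightarrow> 'a \<Rightarrow> 'a \<Rightarrow> real) \<Rightarrow> 'a \<Rightarrow> 'a set" where
  "horizontal f V g x = {H\<in>V. \<forall>K\<in>V. differential f x K = 0 \<longrightarrow> g x H K = 0}"

text \<open>\<open>V\<close> and \<open>W\<close> are the tangent spaces of \<open>M\<close> and \<open>N\<close>.\<close>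

definition riemannian_submersion ::
  "('a::real_normed_vector \<Rightarrow> 'b::real_normed_vector) \<Rightarrow> 'a set \<Rightarrow> 'a set \<Rightarrow> ('a \<Rightarrow> 'a \<Rightarrow> 'a \<Rightarrow> real)
     \<Rightarrow> 'b set \<Rightarrow> 'b set \<Rightarrow> ('b \<Rightarrow> 'b \<Rightarrow> 'b \<Rightarrow> real) \<Rightarrow> bool" where
  "riemannian_submersion f M V g N W h \<longleftrightarrow>
     f ` M = N \<and>
     (\<forall>x\<in>M. f differentiable (at x within M) \<and>
            differential f x ` V = W \<and>
            (\<forall>H\<in>horizontal f V g x. \<forall>K\<in>horizontal f V g x.
               h (f x) (differential f x H) (differential f x K) = g x H K))"

definition Sym :: "(real^'n^'n) set" where
  "Sym = {S. transpose S = S}"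

definition SPD :: "(real^'n^'n) set" where
  "SPD = {S \<in> Sym. \<forall>x. x \<noteq> 0 \<longrightarrow> x \<bullet> (S *v x) > 0}"

definition Hol :: "(real^'n^'n) set" where
  "Hol = {X \<in> Sym. \<forall>i. X $ i $ i = 0}"

definition Cor :: "(real^'n^'n) set" where
  "Cor = {C \<in> SPD. \<forall>i. C $ i $ i = 1}"

definition Diag :: "real^'n^'n \<Rightarrow> real^'n^'n" where
  "Diag A = (\<chi> i j. if i = j then A $ i $ i else 0)"

definition Diag_inv_sqrt :: "real^'n^'n \<Rightarrow> real^'n^'n" where
  "Diag_inv_sqrt A = (\<chi> i j. if i = j then 1 / sqrt (A $ i $ i) else 0)"

definition cor :: "real^'n^'n \<Rightarrow> real^'n^'n" where
  "cor \<Sigma> = Diag_inv_sqrt \<Sigma> ** \<Sigma> ** Diag_inv_sqrt \<Sigma>"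

definition C2 :: "real \<Rightarrow> real^2^2" where
  "C2 \<rho> = vector [vector [1, \<rho>], vector [\<rho>, 1]]"

definition affine_invariant_metric ::
  "real \<Rightarrow> real \<Rightarrow> real^'n^'n \<Rightarrow> real^'n^'n \<Rightarrow> real^'n^'n \<Rightarrow> real" where
  "affine_invariant_metric \<alpha> \<beta> \<Sigma> V W =
     \<alpha> * trace (matrix_inv \<Sigma> ** V ** matrix_inv \<Sigma> ** W)
     + \<beta> * trace (matrix_inv \<Sigma> ** V) * trace (matrix_inv \<Sigma> ** W)"

text \<open>
  \<open>g\<close> is the quotient by \<open>cor\<close> of the affine-invariant metric with parameters \<open>\<alpha>, \<beta>\<close>; the
  condition determines \<open>g\<close> at the points of \<open>Cor\<close> on tangent vectors.
\<close>

definition quotient_affine_metric ::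
  "real \<Rightarrow> real \<Rightarrow> (real^'n^'n \<Rightarrow> real^'n^'n \<Rightarrow> real^'n^'n \<Rightarrow> real) \<Rightarrow> bool" where
  "quotient_affine_metric \<alpha> \<beta> g \<longleftrightarrow>
     \<alpha> > 0 \<and> \<beta> > - \<alpha> / real CARD('n) \<and>
     riemannian_submersion cor SPD Sym (affine_invariant_metric \<alpha> \<beta>) Cor Hol g"

text \<open>
  Lower triangularity is spelled out in coordinates: the order of the index type \<open>2\<close> is
  unsuitable, as its numerals satisfy \<open>(2::2) < 1\<close>.
\<close>

definition LT0 :: "(real^2^2) set" where
  "LT0 = {A. A $ 1 $ 1 = 0 \<and> A $ 1 $ 2 = 0 \<and> A $ 2 $ 2 = 0}"

definition Chol :: "real^2^2 \<Rightarrow> real^2^2" where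
  "Chol C = (THE L. L $ 1 $ 2 = 0 \<and> L $ 1 $ 1 > 0 \<and> L $ 2 $ 2 > 0 \<and> C = L ** transpose L)"

text \<open>
  The metric induced on the hyperboloid sheet by \<open>v\<^sub>1\<^sup>2 - v\<^sub>2\<^sup>2\<close> (polarised), and its pullback to the open half-circle
  by \<open>x \<mapsto> (x\<^sub>1, 1) / x\<^sub>2\<close>. That formula makes sense on the open half-plane \<open>x\<^sub>2 > 0\<close>, and its
  differential on tangent vectors of the half-circle is computed there.
\<close>

definition minkowski :: "real^2 \<Rightarrow> real^2 \<Rightarrow> real^2 \<Rightarrow> real" where
  "minkowski y v w = v $ 1 * w $ 1 - v $ 2 * w $ 2"

definition half_circle_metric :: "real^2 \<Rightarrow> real^2 \<Rightarrow> real^2 \<Rightarrow> real" where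
  "half_circle_metric = pullback_metric (\<lambda>x. (1 / x $ 2) *\<^sub>R vector [x $ 1, 1]) minkowski"

definition poly_hyperbolic_cholesky_metric ::
  "real \<Rightarrow> real^2^2 \<Rightarrow> real^2^2 \<Rightarrow> real^2^2 \<Rightarrow> real" where
  "poly_hyperbolic_cholesky_metric \<alpha>\<^sub>1 =
     pullback_metric (\<lambda>C. Chol C $ 2) (\<lambda>x v w. \<alpha>\<^sub>1 * half_circle_metric x v w)"

definition Theta :: "real^2^2 \<Rightarrow> real^2^2" where
  "Theta C = matrix_inv (Diag (Chol C)) ** Chol C"

definition mexp :: "real^'n^'n \<Rightarrow> real^'n^'n" where
  "mexp A = (\<Sum>k. (1 / fact k) *\<^sub>R (((**) A) ^^ k) (mat 1))"

text \<open>The matrix logarithm of unipotent lower triangular matrices, with values in \<open>LT0\<close>.\<close>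

definition mlog :: "real^2^2 \<Rightarrow> real^2^2" where
  "mlog = the_inv_into LT0 mexp"

definition euclidean_cholesky_metric ::
  "(real^2^2 \<Rightarrow> real^2^2 \<Rightarrow> real) \<Rightarrow> real^2^2 \<Rightarrow> real^2^2 \<Rightarrow> real^2^2 \<Rightarrow> real" where
  "euclidean_cholesky_metric b = pullback_metric Theta (\<lambda>_. b)"

definition log_euclidean_cholesky_metric ::
  "(real^2^2 \<Rightarrow> real^2^2 \<Rightarrow> real) \<Rightarrow> real^2^2 \<Rightarrow> real^2^2 \<Rightarrow> real^2^2 \<Rightarrow> real" where
  "log_euclidean_cholesky_metric b = pullback_metric (mlog \<circ> Theta) (\<lambda>_. b)"

definition lie_cholesky_geodesic :: "real^2^2 \<Rightarrow> real^2^2 \<Rightarrow> real \<Rightarrow> real^2^2" where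
  "lie_cholesky_geodesic A B t =
     the_inv_into Cor Theta (Theta A ** mexp (t *\<^sub>R mlog (matrix_inv (Theta A) ** Theta B)))"

end

theory Submission
  imports Defs
begin

text \<open>
  \<open>Cor\<close> is the curve \<open>C2 r\<close>, \<open>-1 < r < 1\<close>, so a metric on it has the form \<open>k \<phi>'(r)\<^sup>2 dr\<^sup>2\<close> and is
  flat in the coordinate \<open>\<phi>\<close>. Both the quotient-affine and the poly-hyperbolic-Cholesky
  metrics are multiples of \<open>dr\<^sup>2 / (1 - r\<^sup>2)\<^sup>2\<close>, with \<open>\<phi> = artanh\<close>. In dimension 2 the matrix logarithm
  only subtracts the identity, so both Cholesky metrics have the coordinate
  \<open>\<phi>(r) = r / sqrt (1 - r\<^sup>2)\<close>, the subdiagonal entry of \<open>Theta (C2 r)\<close>. Both coordinates map onto the whole line,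
  hence the geodesics are complete.
\<close>

subsection \<open>Two-by-two matrices\<close>

text \<open>The quotient-affine metric is given only by the submersion condition, so it has to be
  read off from horizontal lifts. The fibres of \<open>cor\<close> are the orbits of congruence by
  positive diagonal matrices, and \<open>H\<close> is horizontal at \<open>S\<close> exactly when
  \<open>matrix_inv S ** H\<close> has zero diagonal. Such vectors have trace zero against
  \<open>S\<close>, which removes \<beta>, and the two equal off-diagonal contributions to the
  remaining trace give the factor 2 between the scales of the two hyperbolic metrics. The quotient
  exists because everything depends on the point of the fibre only through its correlation and the
  normalised off-diagonal entry \<open>y / (sqrt a * sqrt d)\<close>. Uniqueness of geodesics comes
  from explicit integration: the covariant acceleration is a nonzero multiple of the second
  derivative of the flat coordinate along the curve. This is why the statements about Levi-Civita
  geodesics are equivalences.\<close>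

definition mat2 :: "'a \<Rightarrow> 'a \<Rightarrow> 'a \<Rightarrow> 'a \<Rightarrow> 'a::zero^2^2" where
  "mat2 a b c d = vector [vector [a, b], vector [c, d]]"

abbreviation sym2 :: "'a \<Rightarrow> 'a \<Rightarrow> 'a \<Rightarrow> 'a::zero^2^2" where
  "sym2 a b d \<equiv> mat2 a b b d"

abbreviation offd :: "real \<Rightarrow> real^2^2" where
  "offd x \<equiv> sym2 0 x 0"

lemma mat2_nth [simp]:
  "mat2 a b c d $ 1 $ 1 = a" "mat2 a b c d $ 1 $ 2 = b"
  "mat2 a b c d $ 2 $ 1 = c" "mat2 a b c d $ 2 $ 2 = d"
  by (simp_all add: mat2_def)

lemma mat2_row2: "mat2 a b c d $ 2 = vector [c, d]"
  by (simp add: mat2_def)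

lemma matrix_eq_2: "A = B \<longleftrightarrow> A$1$1 = B$1$1 \<and> A$1$2 = B$1$2 \<and> A$2$1 = B$2$1 \<and> A$2$2 = B$2$2"
  for A B :: "'a^2^2"
  by (auto simp: vec_eq_iff forall_2)

lemma mat2_eq_iff [simp]: "mat2 a b c d = mat2 a' b' c' d' \<longleftrightarrow> a = a' \<and> b = b' \<and> c = c' \<and> d = d'"
  by (simp add: matrix_eq_2)

lemma mat2_eta: "A = mat2 (A$1$1) (A$1$2) (A$2$1) (A$2$2)"
  by (simp add: matrix_eq_2)

lemma mat2_add: "mat2 a b c d + mat2 a' b' c' d' = mat2 (a + a') (b + b') (c + c') (d + d')"
  for a :: "'a::monoid_add"
  by (simp add: matrix_eq_2)

lemma mat2_scaleR: "r *\<^sub>R mat2 a b c d = mat2 (r * a) (r * b) (r * c) (r * d)"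
  for a :: real
  by (simp add: matrix_eq_2)

lemma mat2_mult:
  "mat2 a b c d ** mat2 a' b' c' d' =
    mat2 (a * a' + b * c') (a * b' + b * d') (c * a' + d * c') (c * b' + d * d')"
  for a :: "'a::semiring_1"
  by (simp add: matrix_eq_2 matrix_matrix_mult_def sum_2)

lemma mat2_transpose: "transpose (mat2 a b c d) = mat2 a c b d"
  by (simp add: matrix_eq_2 transpose_def)

lemma trace_mat2: "trace (mat2 a b c d) = a + d"
  for a :: "'a::semiring_1"
  by (simp add: trace_def sum_2)

lemma mat_1_eq_mat2: "mat 1 = mat2 1 0 0 (1::'a::zero_neq_one)"
  by (simp add: matrix_eq_2 mat_def)

lemma zero_eq_mat2: "0 = mat2 0 0 0 (0::'a::zero)"
  by (simp add: matrix_eq_2)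

lemma Diag_mat2: "Diag (mat2 a b c d) = mat2 a 0 0 d"
  by (simp add: matrix_eq_2 Diag_def)

text \<open>\<open>matrix_inv\<close> is a Hilbert choice, so it is identified through uniqueness of
  two-sided inverses; for square matrices over a field a right inverse is also a left one.\<close>

lemma matrix_inv_eqI:
  fixes A B :: "'a::field^'n^'n"
  assumes "A ** B = mat 1"
  shows "matrix_inv A = B"
proof -
  have BA: "B ** A = mat 1"
    using assms by (simp add: matrix_left_right_inverse)
  have "A ** matrix_inv A = mat 1 \<and> matrix_inv A ** A = mat 1"
    unfolding matrix_inv_def by (rule someI[of _ B]) (simp add: assms BA)
  then show ?thesis
    by (metis BA matrix_mul_assoc matrix_mul_lid matrix_mul_rid)
qed

lemma matrix_inv_mat2:
  fixes a :: "'a::field"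
  assumes "a * d - b * c \<noteq> 0"
  shows "matrix_inv (mat2 a b c d) =
    mat2 (d / (a * d - b * c)) (- b / (a * d - b * c)) (- c / (a * d - b * c)) (a / (a * d - b * c))"
proof (rule matrix_inv_eqI)
  show "mat2 a b c d **
    mat2 (d / (a * d - b * c)) (- b / (a * d - b * c)) (- c / (a * d - b * c)) (a / (a * d - b * c)) = mat 1"
    using assms by (simp add: mat2_mult mat_1_eq_mat2 divide_simps)
qed

lemma C2_eq_mat2: "C2 r = sym2 1 r 1"
  by (simp add: C2_def mat2_def)

lemma C2_add_offd: "C2 r + s *\<^sub>R offd x = C2 (r + s * x)"
  by (simp add: C2_eq_mat2 mat2_add mat2_scaleR)

lemma C2_eq_iff [simp]: "C2 r = C2 q \<longleftrightarrow> r = q"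
  by (simp add: C2_eq_mat2)

lemma Sym_2: "Sym = {sym2 a b d | a b d. True}"
proof -
  have "S = sym2 (S$1$1) (S$1$2) (S$2$2)" if "S \<in> Sym" for S :: "real^2^2"
  proof -
    have "transpose S $ 1 $ 2 = S $ 2 $ 1"
      by (simp add: transpose_def)
    with that show ?thesis
      unfolding matrix_eq_2 Sym_def by simp
  qed
  moreover have "sym2 a b d \<in> Sym" for a b d :: real
    by (simp add: Sym_def mat2_transpose)
  ultimately show ?thesis
    by blast
qed

lemma Hol_2: "Hol = range offd"
  by (auto simp: Hol_def Sym_2 forall_2)

lemma quadratic_form_mat2:
  "x \<bullet> (sym2 a b d *v x) = a * (x$1)\<^sup>2 + 2 * b * x$1 * x$2 + d * (x$2)\<^sup>2"
  for a :: real
  by (simp add: inner_vec_def matrix_vector_mult_def sum_2 algebra_simps power2_eq_square)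

lemma sym2_in_SPD: "sym2 a b d \<in> SPD \<longleftrightarrow> a > 0 \<and> d > 0 \<and> a * d - b\<^sup>2 > 0"
proof
  assume S: "sym2 a b d \<in> SPD"
  have *: "a * x\<^sup>2 + 2 * b * x * y + d * y\<^sup>2 > 0" if "x \<noteq> 0 \<or> y \<noteq> 0" for x y
  proof -
    have "vector [x, y] \<noteq> (0::real^2)"
      using that by (auto simp: vec_eq_iff forall_2)
    then show ?thesis
      using S quadratic_form_mat2[of "vector [x, y]" a b d] by (auto simp: SPD_def)
  qed
  have a: "a > 0" and d: "d > 0"
    using *[of 1 0] *[of 0 1] by auto
  \<comment> \<open>The test vector \<open>(- b, a)\<close> is orthogonal to the first row, so its
    quadratic form is \<open>a\<close> times the determinant.\<close>
  have "a * (a * d - b\<^sup>2) > 0"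
    using *[of "- b" a] a by (simp add: algebra_simps power2_eq_square)
  with a d show "a > 0 \<and> d > 0 \<and> a * d - b\<^sup>2 > 0"
    by (simp add: zero_less_mult_iff)
next
  assume A: "a > 0 \<and> d > 0 \<and> a * d - b\<^sup>2 > 0"
  have "x \<bullet> (sym2 a b d *v x) > 0" if "x \<noteq> 0" for x
  proof -
    have nz: "x$1 \<noteq> 0 \<or> x$2 \<noteq> 0"
      using that by (auto simp: vec_eq_iff forall_2)
    \<comment> \<open>Completing the square; the factor \<open>a\<close> avoids division.\<close>
    have "a * (x \<bullet> (sym2 a b d *v x)) = (a * x$1 + b * x$2)\<^sup>2 + (a * d - b\<^sup>2) * (x$2)\<^sup>2"
      by (simp add: quadratic_form_mat2 algebra_simps power2_eq_square)
    also have "\<dots> > 0"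
    proof (cases "x$2 = 0")
      case True
      then show ?thesis using nz A by simp
    next
      case False
      then show ?thesis using A by (intro add_nonneg_pos) auto
    qed
    finally show ?thesis
      using A by (simp add: zero_less_mult_iff)
  qed
  moreover have "sym2 a b d \<in> Sym"
    by (auto simp: Sym_2)
  ultimately show "sym2 a b d \<in> SPD"
    by (simp add: SPD_def)
qed

lemma C2_in_Cor: "C2 r \<in> Cor \<longleftrightarrow> r \<in> {-1<..<1}"
proof -
  have "C2 r \<in> Cor \<longleftrightarrow> r\<^sup>2 < 1"
    unfolding Cor_def C2_eq_mat2 by (simp add: sym2_in_SPD forall_2)
  then show ?thesis
    by (simp add: abs_square_less_1 abs_less_iff) linarith
qed

lemma Cor_2: "Cor = C2 ` {-1<..<1}"
proof -
  have "\<exists>r. C = C2 r" if "C \<in> Cor" for C :: "real^2^2"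
  proof -
    have "C $ 1 $ 1 = 1" "C $ 2 $ 2 = 1" "C \<in> Sym"
      using that by (simp_all add: Cor_def SPD_def)
    then show ?thesis
      unfolding Sym_2 C2_eq_mat2 by (elim CollectE exE conjE) simp
  qed
  then show ?thesis
    using C2_in_Cor by blast
qed

subsection \<open>Metrics and geodesics on the curve of correlation matrices\<close>

text \<open>A line through \<open>C2 r\<close> in a tangent direction stays on the curve for small
  parameters. A formula for \<open>f\<close> on the correlation matrices alone therefore determines
  the differential, which matters for maps such as \<open>Chol\<close> whose values elsewhere are
  not controlled.\<close>

lemma differential_C2:
  fixes f :: "real^2^2 \<Rightarrow> 'b::real_normed_vector"
  assumes r: "r \<in> {-1<..<1}"
    and f: "\<And>q. q \<in> {-1<..<1} \<Longrightarrow> f (C2 q) = h q"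
    and h: "(h has_vector_derivative D) (at r)"
  shows "differential f (C2 r) (offd x) = x *\<^sub>R D"
proof -
  let ?U = "(\<lambda>s. r + s * x) -` {-1<..<1}"
  have U: "open ?U"
    by (intro open_vimage continuous_intros)
  have "((\<lambda>s. r + s * x) has_vector_derivative x) (at 0)"
    by (auto intro!: derivative_eq_intros simp flip: has_real_derivative_iff_has_vector_derivative)
  from vector_diff_chain_at[OF this, of h D] h
  have "((\<lambda>s. h (r + s * x)) has_vector_derivative x *\<^sub>R D) (at 0)"
    by (simp add: o_def)
  then have "((\<lambda>s. f (C2 r + s *\<^sub>R offd x)) has_vector_derivative x *\<^sub>R D) (at 0)"
    by (rule has_vector_derivative_transform_within_open[OF _ U])
      (use r in \<open>auto simp: C2_add_offd f\<close>)
  then show ?thesis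
    unfolding differential_def by (rule vector_derivative_at)
qed

lemma differential_C2_real:
  fixes f :: "real^2^2 \<Rightarrow> real"
  assumes "r \<in> {-1<..<1}" "\<And>q. q \<in> {-1<..<1} \<Longrightarrow> f (C2 q) = h q"
    and "(h has_real_derivative D) (at r)"
  shows "differential f (C2 r) (offd x) = x * D"
  using differential_C2[OF assms(1), where f = f and h = h] assms(2,3)
  by (simp add: has_real_derivative_iff_has_vector_derivative)

text \<open>In dimension one the three terms of Koszul's formula are equal and one enters with a
  minus sign, which leaves half of the derivative of the metric coefficient.\<close>

lemma koszul_C2:
  assumes r: "r \<in> {-1<..<1}"
    and g: "\<And>q y z. q \<in> {-1<..<1} \<Longrightarrow> g (C2 q) (offd y) (offd z) = m q * y * z"
    and m: "(m has_real_derivative m') (at r)"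
  shows "koszul g (C2 r) (offd x) (offd x) (offd z) = m' * x\<^sup>2 * z / 2"
proof -
  have "differential (\<lambda>A. g A (offd y) (offd z)) (C2 r) (offd x) = x * (m' * y * z)" for x y z
    by (rule differential_C2_real[OF r, where h = "\<lambda>q. m q * y * z"])
      (auto simp: g intro!: derivative_eq_intros m)
  then show ?thesis
    by (simp add: koszul_def algebra_simps power2_eq_square)
qed

lemma C2_has_vector_derivative:
  assumes "(r has_real_derivative r') (at t)"
  shows "((\<lambda>t. C2 (r t)) has_vector_derivative offd r') (at t)"
proof -
  have "((\<lambda>t. C2 0 + r t *\<^sub>R offd 1) has_vector_derivative r' *\<^sub>R offd 1) (at t)"
    using assms by (auto intro!: derivative_eq_intros)
  then show ?thesis
    unfolding C2_add_offd by (simp add: mat2_scaleR)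
qed

lemma offd_has_vector_derivative:
  assumes "(v has_real_derivative a) (at t)"
  shows "((\<lambda>t. offd (v t)) has_vector_derivative offd a) (at t)"
proof -
  have "offd x = C2 x - C2 0" for x
    using C2_add_offd[of 0 1 x] by (simp add: algebra_simps)
  then show ?thesis
    using C2_has_vector_derivative[OF assms] by (auto intro!: derivative_eq_intros)
qed

lemma has_vector_derivative_nth:
  assumes "(f has_vector_derivative D) F"
  shows "((\<lambda>t. f t $ i) has_vector_derivative D $ i) F"
  by (rule bounded_linear.has_vector_derivative[OF bounded_linear_vec_nth assms])

lemma has_vector_derivative_nth2:
  fixes f :: "real \<Rightarrow> real^'m^'n"
  assumes "(f has_vector_derivative D) (at t)"
  shows "((\<lambda>t. f t $ i $ j) has_real_derivative D $ i $ j) (at t)"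
  using has_vector_derivative_nth[OF has_vector_derivative_nth[OF assms]]
  by (simp add: has_real_derivative_iff_has_vector_derivative)

lemma affine_if_second_derivative_0:
  fixes f :: "real \<Rightarrow> real"
  assumes f: "\<And>t. (f has_real_derivative f' t) (at t)"
    and f': "\<And>t. (f' has_real_derivative 0) (at t)"
  shows "f t = (1 - t) * f 0 + t * f 1"
proof -
  have c: "f' t = f' 0" for t
    using f' DERIV_isconst_all by blast
  have "((\<lambda>t. f t - t * f' 0) has_real_derivative 0) (at t)" for t
    using c[of t] by (auto intro!: derivative_eq_intros f)
  then have "f t - t * f' 0 = f 0 - 0 * f' 0" for t
    using DERIV_isconst_all by blast
  from this[of t] this[of 1] show ?thesis
    by (simp add: algebra_simps)
qed

text \<open>
  A metric \<open>k \<phi>'(r)\<^sup>2 dr\<^sup>2\<close> is Euclidean in the coordinate \<open>\<phi>\<close>, so its geodesics are the curves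
  affine in that coordinate.
\<close>

lemma geodesic_C2_iff:
  fixes \<phi> \<phi>' \<phi>'' \<psi> :: "real \<Rightarrow> real"
  assumes g: "\<And>r x y. r \<in> {-1<..<1} \<Longrightarrow> g (C2 r) (offd x) (offd y) = k * (\<phi>' r)\<^sup>2 * x * y"
    and k: "k > 0"
    and \<phi>: "\<And>r. r \<in> {-1<..<1} \<Longrightarrow> (\<phi> has_real_derivative \<phi>' r) (at r)"
    and \<phi>': "\<And>r. r \<in> {-1<..<1} \<Longrightarrow> (\<phi>' has_real_derivative \<phi>'' r) (at r)"
    and nz: "\<And>r. r \<in> {-1<..<1} \<Longrightarrow> \<phi>' r \<noteq> 0"
    and \<psi>: "\<And>u. \<psi> u \<in> {-1<..<1}" "\<And>u. \<phi> (\<psi> u) = u" "\<And>r. r \<in> {-1<..<1} \<Longrightarrow> \<psi> (\<phi> r) = r"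
    and \<psi>': "\<And>u. (\<psi> has_real_derivative 1 / \<phi>' (\<psi> u)) (at u)"
    and r: "r\<^sub>1 \<in> {-1<..<1}" "r\<^sub>2 \<in> {-1<..<1}"
  shows "geodesic Cor Hol g \<gamma> \<and> \<gamma> 0 = C2 r\<^sub>1 \<and> \<gamma> 1 = C2 r\<^sub>2 \<longleftrightarrow>
    (\<forall>t. \<gamma> t = C2 (\<psi> ((1 - t) * \<phi> r\<^sub>1 + t * \<phi> r\<^sub>2)))"
proof -
  \<comment> \<open>With \<open>v\<close> and \<open>a\<close> the first two derivatives of a curve
    in the parameter \<open>r\<close>, the last bracket is the second derivative of \<phi> along the
    curve. It arises because the coefficient \<open>k * (\<phi>' r)\<^sup>2\<close> has
    half-derivative \<open>k * \<phi>' r * \<phi>'' r\<close>.\<close>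
  have acc: "g (C2 r) (offd a) (offd z) + koszul g (C2 r) (offd v) (offd v) (offd z)
      = k * \<phi>' r * z * (\<phi>' r * a + \<phi>'' r * v\<^sup>2)" if "r \<in> {-1<..<1}" for r a v z
  proof -
    have "((\<lambda>r. k * (\<phi>' r)\<^sup>2) has_real_derivative k * (2 * \<phi>' r * \<phi>'' r)) (at r)"
      by (auto intro!: derivative_eq_intros \<phi>'[OF that])
    from koszul_C2[OF that g this] g[OF that] show ?thesis
      by (simp add: algebra_simps power2_eq_square)
  qed
  show ?thesis
  proof
    assume A: "geodesic Cor Hol g \<gamma> \<and> \<gamma> 0 = C2 r\<^sub>1 \<and> \<gamma> 1 = C2 r\<^sub>2"
    define \<rho> where "\<rho> t = \<gamma> t $ 1 $ 2" for t
    from A obtain v a where v: "\<And>t. (\<gamma> has_vector_derivative v t) (at t)"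
      and a: "\<And>t. (v has_vector_derivative a t) (at t)"
      and geo: "\<And>t Z. Z \<in> Hol \<Longrightarrow> g (\<gamma> t) (a t) Z + koszul g (\<gamma> t) (v t) (v t) Z = 0"
      and M: "\<And>t. \<gamma> t \<in> Cor"
      unfolding geodesic_def by blast
    have \<gamma>: "\<gamma> t = C2 (\<rho> t)" and in1: "\<rho> t \<in> {-1<..<1}" for t
      using M[of t] by (auto simp: Cor_2 \<rho>_def C2_eq_mat2)
    define v1 where "v1 t = v t $ 1 $ 2" for t
    define a1 where "a1 t = a t $ 1 $ 2" for t
    have \<rho>: "(\<rho> has_real_derivative v1 t) (at t)" for t
      unfolding \<rho>_def v1_def by (rule has_vector_derivative_nth2[OF v])
    have v1: "(v1 has_real_derivative a1 t) (at t)" for t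
      unfolding v1_def a1_def by (rule has_vector_derivative_nth2[OF a])
    \<comment> \<open>\<open>geodesic\<close> does not ask for \<open>v\<close> and \<open>a\<close>
      to be tangent; uniqueness of derivatives along the curve forces it.\<close>
    have veq: "v t = offd (v1 t)" for t
      using vector_derivative_unique_at[OF v C2_has_vector_derivative[OF \<rho>, folded \<gamma>]] .
    have aeq: "a t = offd (a1 t)" for t
      using vector_derivative_unique_at[OF a offd_has_vector_derivative[OF v1, folded veq]] .
    have eq: "\<phi>' (\<rho> t) * a1 t + \<phi>'' (\<rho> t) * (v1 t)\<^sup>2 = 0" for t
      using geo[of "offd 1" t] acc[OF in1, of t "a1 t" 1 "v1 t"] k nz[OF in1, of t]
      by (simp add: Hol_2 \<gamma> veq aeq)
    have d1: "((\<lambda>t. \<phi> (\<rho> t)) has_real_derivative \<phi>' (\<rho> t) * v1 t) (at t)" for t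
      by (rule DERIV_chain2[OF \<phi>[OF in1] \<rho>])
    have "((\<lambda>t. \<phi>' (\<rho> t) * v1 t) has_real_derivative \<phi>' (\<rho> t) * a1 t + \<phi>'' (\<rho> t) * v1 t * v1 t) (at t)" for t
      by (rule DERIV_mult'[OF DERIV_chain2[OF \<phi>'[OF in1] \<rho>] v1])
    then have d2: "((\<lambda>t. \<phi>' (\<rho> t) * v1 t) has_real_derivative 0) (at t)" for t
      by (rule DERIV_cong) (use eq[of t] in \<open>simp add: power2_eq_square\<close>)
    have e: "\<rho> 0 = r\<^sub>1" "\<rho> 1 = r\<^sub>2"
      using A \<gamma> by (metis C2_eq_iff)+
    show "\<forall>t. \<gamma> t = C2 (\<psi> ((1 - t) * \<phi> r\<^sub>1 + t * \<phi> r\<^sub>2))"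
      using affine_if_second_derivative_0[OF d1 d2] \<psi>(3)[OF in1] e by (metis \<gamma>)
  next
    assume A: "\<forall>t. \<gamma> t = C2 (\<psi> ((1 - t) * \<phi> r\<^sub>1 + t * \<phi> r\<^sub>2))"
    define q where "q = \<phi> r\<^sub>2 - \<phi> r\<^sub>1"
    define u where "u t = (1 - t) * \<phi> r\<^sub>1 + t * \<phi> r\<^sub>2" for t
    define r' where "r' t = q / \<phi>' (\<psi> (u t))" for t
    \<comment> \<open>Obtained by solving \<open>\<phi>' * r'' + \<phi>'' * r'\<^sup>2 = 0\<close>,
      the vanishing of the bracket in \<open>acc\<close>; differentiating \<open>r'\<close> by the
      quotient rule gives the same value.\<close>
    define r'' where "r'' t = - \<phi>'' (\<psi> (u t)) * (r' t)\<^sup>2 / \<phi>' (\<psi> (u t))" for t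
    have u: "(u has_real_derivative q) (at t)" for t
      unfolding u_def q_def by (auto intro!: derivative_eq_intros)
    have d1: "((\<lambda>t. \<psi> (u t)) has_real_derivative r' t) (at t)" for t
      using DERIV_chain2[OF \<psi>' u, of t] by (simp add: r'_def)
    have d2: "(r' has_real_derivative r'' t) (at t)" for t
      unfolding r'_def
      by (rule derivative_eq_intros DERIV_chain2[OF \<phi>'[OF \<psi>(1)] d1] nz \<psi>(1) refl)+
        (use nz[OF \<psi>(1), of "u t"] in \<open>simp add: r''_def r'_def field_simps power2_eq_square\<close>)
    have \<gamma>: "\<gamma> = (\<lambda>t. C2 (\<psi> (u t)))"
      using A by (auto simp: u_def)
    have "(\<gamma> has_vector_derivative offd (r' t)) (at t)" for t
      unfolding \<gamma> by (rule C2_has_vector_derivative[OF d1])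
    moreover have "((\<lambda>t. offd (r' t)) has_vector_derivative offd (r'' t)) (at t)" for t
      by (rule offd_has_vector_derivative[OF d2])
    moreover have "g (\<gamma> t) (offd (r'' t)) Z + koszul g (\<gamma> t) (offd (r' t)) (offd (r' t)) Z = 0"
      if "Z \<in> Hol" for t Z
      using that acc[OF \<psi>(1), of "u t" "r'' t" _ "r' t"] nz[OF \<psi>(1), of "u t"]
      by (auto simp: Hol_2 \<gamma> r''_def)
    moreover have "\<gamma> t \<in> Cor" for t
      using \<psi>(1)[of "u t"] by (simp add: \<gamma> C2_in_Cor)
    ultimately have "geodesic Cor Hol g \<gamma>"
      unfolding geodesic_def by (intro conjI allI exI[of _ "\<lambda>t. offd (r' t)"] exI[of _ "\<lambda>t. offd (r'' t)"]) auto
    then show "geodesic Cor Hol g \<gamma> \<and> \<gamma> 0 = C2 r\<^sub>1 \<and> \<gamma> 1 = C2 r\<^sub>2"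
      using A \<psi>(3) r by simp
  qed
qed

subsection \<open>Cholesky metrics\<close>

lemma has_vector_derivative_vector_2:
  fixes f g :: "real \<Rightarrow> real"
  assumes "(f has_real_derivative f') (at t within S)" "(g has_real_derivative g') (at t within S)"
  shows "((\<lambda>t. vector [f t, g t] :: real^2) has_vector_derivative vector [f', g']) (at t within S)"
proof -
  have e: "vector [x, y] = x *\<^sub>R vector [1, 0] + y *\<^sub>R (vector [0, 1] :: real^2)" for x y
    by (simp add: vec_eq_iff forall_2)
  have "((\<lambda>t. f t *\<^sub>R vector [1, 0] + g t *\<^sub>R (vector [0, 1] :: real^2))
      has_vector_derivative f' *\<^sub>R vector [1, 0] + g' *\<^sub>R vector [0, 1]) (at t within S)"
    using assms by (auto intro!: derivative_eq_intros)
  then show ?thesis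
    by (simp only: e[symmetric])
qed

lemma one_minus_square_pos: "0 < 1 - r\<^sup>2" if "r \<in> {-1<..<1}" for r :: real
  using that by (simp add: abs_square_less_1 abs_less_iff)

text \<open>Comparing entries leaves only choices of sign, and positivity of the diagonal fixes
  them; this gives the uniqueness that the definite description requires.\<close>

lemma Chol_C2:
  assumes "r \<in> {-1<..<1}"
  shows "Chol (C2 r) = mat2 1 0 r (sqrt (1 - r\<^sup>2))"
  unfolding Chol_def
proof (rule the_equality)
  have s: "1 - r\<^sup>2 > 0"
    using assms by (rule one_minus_square_pos)
  then show "mat2 1 0 r (sqrt (1 - r\<^sup>2)) $ 1 $ 2 = 0 \<and> mat2 1 0 r (sqrt (1 - r\<^sup>2)) $ 1 $ 1 > 0 \<and>
    mat2 1 0 r (sqrt (1 - r\<^sup>2)) $ 2 $ 2 > 0 \<and>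
    C2 r = mat2 1 0 r (sqrt (1 - r\<^sup>2)) ** transpose (mat2 1 0 r (sqrt (1 - r\<^sup>2)))"
    by (simp add: C2_eq_mat2 mat2_mult mat2_transpose power2_eq_square)
  fix L :: "real^2^2"
  assume L: "L $ 1 $ 2 = 0 \<and> L $ 1 $ 1 > 0 \<and> L $ 2 $ 2 > 0 \<and> C2 r = L ** transpose L"
  obtain a b c d where abcd: "L = mat2 a b c d"
    using mat2_eta by blast
  from L have e: "b = 0" "a > 0" "d > 0" "a * a = 1" "c * a = r" "c * c + d * d = 1"
    by (auto simp: abcd C2_eq_mat2 mat2_mult mat2_transpose)
  then have "a = 1"
    by (metis abs_of_pos abs_mult_self_eq mult_cancel_left1 power2_eq_square real_sqrt_abs real_sqrt_one)
  with e have "c = r" "d\<^sup>2 = 1 - r\<^sup>2"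
    by (auto simp: power2_eq_square algebra_simps)
  with e \<open>a = 1\<close> show "L = mat2 1 0 r (sqrt (1 - r\<^sup>2))"
    by (metis abcd abs_of_pos real_sqrt_abs)
qed

section \<open>The hyperbolic metric on the half-circle and its pullback\<close>

lemma half_circle_metric_vector:
  assumes "s \<noteq> 0"
  shows "half_circle_metric (vector [r, s]) (vector [v\<^sub>1, v\<^sub>2]) (vector [w\<^sub>1, w\<^sub>2]) =
    (v\<^sub>1 / s - r * v\<^sub>2 / s\<^sup>2) * (w\<^sub>1 / s - r * w\<^sub>2 / s\<^sup>2) - (v\<^sub>2 / s\<^sup>2) * (w\<^sub>2 / s\<^sup>2)"
proof -
  let ?f = "\<lambda>x::real^2. (1 / x $ 2) *\<^sub>R vector [x $ 1, 1] :: real^2"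
  have f: "?f x = vector [x $ 1 / x $ 2, 1 / x $ 2]" for x
    by (simp add: vec_eq_iff forall_2)
  have "differential ?f (vector [r, s]) (vector [v, w]) = vector [v / s - r * w / s\<^sup>2, - w / s\<^sup>2]" for v w
    unfolding differential_def f
    by (rule vector_derivative_at, rule has_vector_derivative_vector_2)
      (auto intro!: derivative_eq_intros simp: assms field_simps power2_eq_square)
  then show ?thesis
    by (simp add: half_circle_metric_def pullback_metric_def minkowski_def)
qed

text \<open>The second Cholesky row \<open>(r, s)\<close> is sent to \<open>(r / s, 1 / s)\<close>,
  which is \<open>(sinh u, cosh u)\<close> for \<open>u = artanh r\<close>. Thus
  \<open>artanh r\<close> is arc length on the hyperbola, and the coefficient is the square of its
  derivative.\<close>

lemma poly_hyperbolic_cholesky_metric_C2: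
  assumes r: "r \<in> {-1<..<1}"
  shows "poly_hyperbolic_cholesky_metric \<alpha> (C2 r) (offd x) (offd y) = \<alpha> * (1 / (1 - r\<^sup>2))\<^sup>2 * x * y"
proof -
  define s where "s = sqrt (1 - r\<^sup>2)"
  have s: "s > 0" and s2: "s\<^sup>2 = 1 - r\<^sup>2"
    using one_minus_square_pos[OF r] by (auto simp: s_def)
  have "((\<lambda>q. vector [q, sqrt (1 - q\<^sup>2)] :: real^2) has_vector_derivative vector [1, - r / s]) (at r)"
    by (rule has_vector_derivative_vector_2)
      (use one_minus_square_pos[OF r] in \<open>auto intro!: derivative_eq_intros simp: s_def divide_simps\<close>)
  then have d: "differential (\<lambda>C. Chol C $ 2) (C2 r) (offd x) = vector [x, x * (- r / s)]" for x
    by (subst differential_C2[OF r, where h = "\<lambda>q. vector [q, sqrt (1 - q\<^sup>2)]"])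
      (auto simp: Chol_C2 mat2_row2 vec_eq_iff forall_2)
  have "poly_hyperbolic_cholesky_metric \<alpha> (C2 r) (offd x) (offd y) =
    \<alpha> * ((x / s - r * (x * (- r / s)) / s\<^sup>2) * (y / s - r * (y * (- r / s)) / s\<^sup>2) -
      (x * (- r / s) / s\<^sup>2) * (y * (- r / s) / s\<^sup>2))"
    using s by (simp only: poly_hyperbolic_cholesky_metric_def pullback_metric_def d Chol_C2[OF r] mat2_row2
        s_def[symmetric] half_circle_metric_vector)
  \<comment> \<open>Since \<open>s\<^sup>2 + r\<^sup>2 = 1\<close>, the numerator is
    \<open>1 - r\<^sup>2\<close>, that is \<open>s\<^sup>2\<close>.\<close>
  also have "\<dots> = \<alpha> * x * y * ((s\<^sup>2 + r\<^sup>2)\<^sup>2 - r\<^sup>2) / s ^ 6"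
    using s by (simp add: field_simps) (simp add: algebra_simps eval_nat_numeral)
  also have "\<dots> = \<alpha> * x * y * s\<^sup>2 / s ^ 6"
    by (simp add: s2)
  also have "\<dots> = \<alpha> * (1 / s\<^sup>2)\<^sup>2 * x * y"
    using s by (simp add: field_simps eval_nat_numeral)
  finally show ?thesis
    by (simp add: s2)
qed

section \<open>Unipotent factors, matrix exponential and logarithm\<close>

lemma Theta_C2:
  assumes "r \<in> {-1<..<1}"
  shows "Theta (C2 r) = mat2 1 0 (r / sqrt (1 - r\<^sup>2)) 1"
  using one_minus_square_pos[OF assms]
  by (simp add: Theta_def Chol_C2[OF assms] Diag_mat2 matrix_inv_mat2 mat2_mult)

text \<open>Strictly lower triangular matrices of size two square to zero, so the exponential series
  stops after its linear term.\<close>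

lemma mexp_LT0: "mexp (mat2 0 0 u 0) = mat2 1 0 u 1"
proof -
  let ?f = "\<lambda>k. (1 / fact k) *\<^sub>R ((**) (mat2 0 0 u 0) ^^ k) (mat 1)"
  have "((**) (mat2 0 0 u 0) ^^ Suc (Suc k)) (mat 1) = 0" for k
    by (induction k) (simp_all add: mat2_mult mat_1_eq_mat2 zero_eq_mat2)
  then have "?f (Suc (Suc k)) = 0" for k
    by (simp only: scaleR_zero_right)
  then have "?f k = 0" if "k \<notin> {0, 1}" for k
    using that by (metis One_nat_def insertI1 insertI2 old.nat.exhaust)
  then have "mexp (mat2 0 0 u 0) = (\<Sum>k\<in>{0, 1}. ?f k)"
    unfolding mexp_def by (intro suminf_finite) auto
  also have "\<dots> = mat2 1 0 u 1"
    by (simp add: mat_1_eq_mat2 mat2_mult mat2_add)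
  finally show ?thesis .
qed

lemma LT0_eq: "LT0 = range (\<lambda>u. mat2 0 0 u 0)"
  by (auto simp: LT0_def matrix_eq_2)

lemma mlog_mat2: "mlog (mat2 1 0 u 1) = mat2 0 0 u 0"
  unfolding mlog_def
  by (rule the_inv_into_f_eq) (auto simp: inj_on_def LT0_eq mexp_LT0)

lemma cholesky_coord_has_derivative:
  assumes "r \<in> {-1<..<1}"
  shows "((\<lambda>r. r / sqrt (1 - r\<^sup>2)) has_real_derivative 1 / sqrt (1 - r\<^sup>2) ^ 3) (at r)"
proof -
  define s where "s = sqrt (1 - r\<^sup>2)"
  have s: "s > 0" and s2: "r\<^sup>2 = 1 - s\<^sup>2"
    using one_minus_square_pos[OF assms] by (auto simp: s_def)
  have "((\<lambda>r. sqrt (1 - r\<^sup>2)) has_real_derivative - r / s) (at r)"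
    using one_minus_square_pos[OF assms] by (auto intro!: derivative_eq_intros simp: s_def divide_simps)
  from DERIV_divide[OF DERIV_ident this, folded s_def] s
  have "((\<lambda>r. r / sqrt (1 - r\<^sup>2)) has_real_derivative (s + r\<^sup>2 / s) / s\<^sup>2) (at r)"
    by (simp add: power2_eq_square)
  also have "(s + r\<^sup>2 / s) / s\<^sup>2 = 1 / s ^ 3"
    unfolding s2 using s by (simp add: field_simps eval_nat_numeral)
  finally show ?thesis
    by (simp add: s_def)
qed

text \<open>The diagonal entry \<open>c\<close> is left free: \<open>c = 1\<close> serves
  \<open>Theta\<close> and \<open>c = 0\<close> serves \<open>mlog \<circ> Theta\<close>.\<close>

lemma has_vector_derivative_LT:
  assumes "(f has_real_derivative f') (at t within S)"
  shows "((\<lambda>t. mat2 c 0 (f t) c) has_vector_derivative f' *\<^sub>R mat2 0 0 1 0) (at t within S)"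
proof -
  have e: "mat2 c 0 u c = mat2 c 0 0 c + u *\<^sub>R mat2 0 0 1 0" for u :: real
    by (simp add: mat2_add mat2_scaleR)
  have "((\<lambda>t. mat2 c 0 0 c + f t *\<^sub>R mat2 0 0 1 0) has_vector_derivative f' *\<^sub>R mat2 0 0 1 0) (at t within S)"
    using assms by (auto intro!: derivative_eq_intros)
  then show ?thesis
    by (simp only: e[symmetric])
qed

text \<open>On the correlation matrices the two maps differ by the constant identity matrix, so they
  have the same differential. This is the reason why the two Cholesky metrics coincide.\<close>

lemma differential_Theta:
  assumes "r \<in> {-1<..<1}"
  shows "differential Theta (C2 r) (offd x) = x *\<^sub>R (1 / sqrt (1 - r\<^sup>2) ^ 3) *\<^sub>R mat2 0 0 1 0"
    and "differential (mlog \<circ> Theta) (C2 r) (offd x) = x *\<^sub>R (1 / sqrt (1 - r\<^sup>2) ^ 3) *\<^sub>R mat2 0 0 1 0"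
proof -
  note d = has_vector_derivative_LT[OF cholesky_coord_has_derivative[OF assms]]
  show "differential Theta (C2 r) (offd x) = x *\<^sub>R (1 / sqrt (1 - r\<^sup>2) ^ 3) *\<^sub>R mat2 0 0 1 0"
    by (rule differential_C2[OF assms _ d[where c = 1]]) (simp add: Theta_C2)
  show "differential (mlog \<circ> Theta) (C2 r) (offd x) = x *\<^sub>R (1 / sqrt (1 - r\<^sup>2) ^ 3) *\<^sub>R mat2 0 0 1 0"
    by (rule differential_C2[OF assms _ d[where c = 0]]) (simp add: Theta_C2 mlog_mat2)
qed

text \<open>\<open>inner_product_on\<close> states homogeneity in the first argument only; the
  second is reached by symmetry.\<close>

lemma inner_product_on_scaleR:
  assumes b: "inner_product_on V b" and V: "subspace V" "X \<in> V"
  shows "b (r *\<^sub>R X) (s *\<^sub>R X) = r * s * b X X"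
proof -
  have "b (r *\<^sub>R X) (s *\<^sub>R X) = r * b X (s *\<^sub>R X)"
    using b V by (simp add: inner_product_on_def subspace_scale)
  also have "b X (s *\<^sub>R X) = b (s *\<^sub>R X) X"
    using b V by (simp add: inner_product_on_def subspace_scale)
  also have "\<dots> = s * b X X"
    using b V by (simp add: inner_product_on_def)
  finally show ?thesis by simp
qed

lemma subspace_LT0: "subspace LT0"
  by (simp add: subspace_def LT0_def)

text \<open>\<open>LT0\<close> is a line, so an inner product on it enters only through the squared
  length \<open>k\<close> of one spanning vector.\<close>

lemma cholesky_metrics_C2:
  assumes b: "inner_product_on LT0 b" and r: "r \<in> {-1<..<1}"
  defines "k \<equiv> b (mat2 0 0 1 0) (mat2 0 0 1 0)"
  shows "euclidean_cholesky_metric b (C2 r) (offd x) (offd y) = k * (1 / sqrt (1 - r\<^sup>2) ^ 3)\<^sup>2 * x * y"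
    and "log_euclidean_cholesky_metric b (C2 r) (offd x) (offd y) = k * (1 / sqrt (1 - r\<^sup>2) ^ 3)\<^sup>2 * x * y"
    and "k > 0"
proof -
  have E: "mat2 0 0 1 0 \<in> LT0"
    by (simp add: LT0_def)
  note sc = inner_product_on_scaleR[OF b subspace_LT0 E]
  show "euclidean_cholesky_metric b (C2 r) (offd x) (offd y) = k * (1 / sqrt (1 - r\<^sup>2) ^ 3)\<^sup>2 * x * y"
    "log_euclidean_cholesky_metric b (C2 r) (offd x) (offd y) = k * (1 / sqrt (1 - r\<^sup>2) ^ 3)\<^sup>2 * x * y"
    by (simp_all only: euclidean_cholesky_metric_def log_euclidean_cholesky_metric_def pullback_metric_def
        differential_Theta[OF r] scaleR_scaleR sc k_def) (simp_all add: power2_eq_square)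
  show "k > 0"
    using b E by (auto simp: inner_product_on_def k_def zero_eq_mat2)
qed

subsection \<open>The quotient-affine metric\<close>

lemma Diag_inv_sqrt_mat2: "Diag_inv_sqrt (mat2 a b c d) = mat2 (1 / sqrt a) 0 0 (1 / sqrt d)"
  by (simp add: matrix_eq_2 Diag_inv_sqrt_def)

lemma cor_sym2:
  assumes "a > 0" "d > 0"
  shows "cor (sym2 a b d) = C2 (b / (sqrt a * sqrt d))"
  using assms by (simp add: cor_def Diag_inv_sqrt_mat2 mat2_mult C2_eq_mat2)

lemma cor_coord_in:
  assumes "a > 0" "d > 0" "a * d - b\<^sup>2 > 0"
  shows "b / (sqrt a * sqrt d) \<in> {-1<..<1}"
proof -
  have "(b / (sqrt a * sqrt d))\<^sup>2 < 1"
    using assms by (simp add: power_divide power_mult_distrib)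
  then show ?thesis
    unfolding abs_square_less_1 abs_less_iff greaterThanLessThan_iff by linarith
qed

lemma cor_image_SPD: "cor ` SPD = (Cor :: (real^2^2) set)"
proof
  show "cor ` SPD \<subseteq> (Cor :: (real^2^2) set)"
  proof clarify
    fix S :: "real^2^2" assume S: "S \<in> SPD"
    then obtain a b d where e: "S = sym2 a b d"
      by (auto simp: SPD_def Sym_2)
    show "cor S \<in> Cor"
      using S cor_coord_in[of a d b] by (simp add: e sym2_in_SPD cor_sym2 C2_in_Cor)
  qed
  show "Cor \<subseteq> cor ` (SPD :: (real^2^2) set)"
  proof
    fix C :: "real^2^2" assume C: "C \<in> Cor"
    then obtain r where "C = C2 r"
      by (auto simp: Cor_2)
    then have "cor C = C"
      by (simp add: C2_eq_mat2 cor_sym2)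
    moreover have "C \<in> SPD"
      using C by (simp add: Cor_def)
    ultimately show "C \<in> cor ` SPD"
      by (metis imageI)
  qed
qed

text \<open>On \<open>SPD\<close> the map \<open>cor\<close> agrees with an affine function of one
  scalar quotient of matrix entries. The agreement relies on symmetry and positive diagonal entries,
  and differentiability within \<open>SPD\<close> can be transferred along it.\<close>

lemma cor_differentiable:
  assumes "S \<in> SPD"
  shows "(cor :: real^2^2 \<Rightarrow> _) differentiable (at S within SPD)"
proof -
  let ?f = "\<lambda>S::real^2^2. S $ 1 $ 2 / (sqrt (S $ 1 $ 1) * sqrt (S $ 2 $ 2))"
  obtain a b d where e: "S = sym2 a b d"
    using assms by (auto simp: SPD_def Sym_2)
  have pos: "a > 0" "d > 0"
    using assms by (auto simp: e sym2_in_SPD)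
  have nth: "(\<lambda>S::real^2^2. S $ i $ j) differentiable F" for i j F
    by (intro bounded_linear_imp_differentiable
        bounded_linear_compose[OF bounded_linear_vec_nth bounded_linear_vec_nth])
  have sq: "(\<lambda>S::real^2^2. sqrt (S $ i $ i)) differentiable (at S within SPD)" for i
  proof -
    have "S $ i $ i > 0"
      using pos by (cases i rule: exhaust_2[THEN disjE]) (auto simp: e)
    then show ?thesis
      using nth[of i i "at S within SPD"] unfolding differentiable_def
      by (elim exE) (rule exI, rule has_derivative_real_sqrt)
  qed
  have "?f differentiable (at S within SPD)"
    using pos by (intro differentiable_divide differentiable_mult nth sq) (auto simp: e)
  then have "(\<lambda>S. C2 0 + ?f S *\<^sub>R offd 1) differentiable (at S within SPD)"
    by (intro differentiable_add differentiable_const differentiable_scaleR)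
  moreover have "C2 0 + ?f T *\<^sub>R offd 1 = cor T" if T: "T \<in> SPD" for T
  proof -
    obtain a b d where "T = sym2 a b d"
      using T by (auto simp: SPD_def Sym_2)
    then show ?thesis
      using T by (simp only: C2_add_offd) (simp add: cor_sym2 sym2_in_SPD)
  qed
  ultimately show ?thesis
    using assms unfolding differentiable_def by (metis (no_types, lifting) has_derivative_transform)
qed

lemma differential_cor:
  assumes pos: "a > 0" "d > 0"
  shows "differential cor (sym2 a b d) (sym2 x y z) =
    offd ((y - b * (x / a + z / d) / 2) / (sqrt a * sqrt d))"
  unfolding differential_def
proof (rule vector_derivative_at)
  let ?U = "(\<lambda>s. a + s * x) -` {0<..} \<inter> (\<lambda>s. d + s * z) -` {0<..}"
  have U: "open ?U"
    by (intro open_Int open_vimage continuous_intros open_greaterThan)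
  have sqrt': "((\<lambda>s. sqrt (c + s * w)) has_real_derivative w / (2 * sqrt c)) (at 0)" if "c > 0" for c w
    using that by (auto intro!: derivative_eq_intros simp: field_simps)
  have "((\<lambda>s. b + s * y) has_real_derivative y) (at 0)"
    by (auto intro!: derivative_eq_intros)
  from DERIV_divide[OF this DERIV_mult[OF sqrt'[OF pos(1), of x] sqrt'[OF pos(2), of z]]]
  have "((\<lambda>s. (b + s * y) / (sqrt (a + s * x) * sqrt (d + s * z))) has_real_derivative
      (y * (sqrt a * sqrt d) - b * (x / (2 * sqrt a) * sqrt d + z / (2 * sqrt d) * sqrt a)) /
      ((sqrt a * sqrt d) * (sqrt a * sqrt d))) (at 0)"
    using pos by simp
  also have "(y * (sqrt a * sqrt d) - b * (x / (2 * sqrt a) * sqrt d + z / (2 * sqrt d) * sqrt a)) /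
      ((sqrt a * sqrt d) * (sqrt a * sqrt d)) = (y - b * (x / a + z / d) / 2) / (sqrt a * sqrt d)"
  proof -
    \<comment> \<open>Free positive variables in place of the square roots turn the identity into
      one between rational functions.\<close>
    have "(y * (p * q) - b * (x / (2 * p) * q + z / (2 * q) * p)) / ((p * q) * (p * q)) =
        (y - b * (x / (p * p) + z / (q * q)) / 2) / (p * q)" if "p > 0" "q > 0" for p q :: real
      using that by (simp add: field_simps)
    from this[of "sqrt a" "sqrt d"] show ?thesis
      using pos by simp
  qed
  finally have "((\<lambda>s. (b + s * y) / (sqrt (a + s * x) * sqrt (d + s * z))) has_real_derivative
      (y - b * (x / a + z / d) / 2) / (sqrt a * sqrt d)) (at 0)" .
  from C2_has_vector_derivative[OF this]
  show "((\<lambda>s. cor (sym2 a b d + s *\<^sub>R sym2 x y z)) has_vector_derivative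
      offd ((y - b * (x / a + z / d) / 2) / (sqrt a * sqrt d))) (at 0)"
    by (rule has_vector_derivative_transform_within_open[OF _ U])
      (use pos in \<open>auto simp: mat2_add mat2_scaleR cor_sym2\<close>)
qed

section \<open>Horizontal lifts for the affine-invariant metric\<close>

lemma affine_invariant_metric_sym2:
  fixes a b d :: real
  defines "D \<equiv> a * d - b\<^sup>2"
  assumes "D \<noteq> 0"
  shows "affine_invariant_metric \<alpha> \<beta> (sym2 a b d) (sym2 x y z) (sym2 x' y' z') =
    \<alpha> * (((d * x - b * y) * (d * x' - b * y') + (d * y - b * z) * (a * y' - b * x') +
      (a * y - b * x) * (d * y' - b * z') + (a * z - b * y) * (a * z' - b * y')) / D\<^sup>2) +
    \<beta> * ((d * x - 2 * b * y + a * z) / D) * ((d * x' - 2 * b * y' + a * z') / D)"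
proof -
  have inv: "matrix_inv (sym2 a b d) = mat2 (d / D) (- b / D) (- b / D) (a / D)"
    using assms by (simp add: D_def matrix_inv_mat2 power2_eq_square)
  have m: "matrix_inv (sym2 a b d) ** sym2 x y z =
      mat2 ((d * x - b * y) / D) ((d * y - b * z) / D) ((a * y - b * x) / D) ((a * z - b * y) / D)" for x y z
    by (simp add: inv mat2_mult diff_divide_distrib algebra_simps)
  have t1: "trace (matrix_inv (sym2 a b d) ** sym2 x y z ** matrix_inv (sym2 a b d) ** sym2 x' y' z') =
    ((d * x - b * y) * (d * x' - b * y') + (d * y - b * z) * (a * y' - b * x') +
      (a * y - b * x) * (d * y' - b * z') + (a * z - b * y) * (a * z' - b * y')) / D\<^sup>2"
    by (subst matrix_mul_assoc[symmetric])
      (simp add: m mat2_mult trace_mat2 power2_eq_square add_divide_distrib)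
  have t2: "trace (matrix_inv (sym2 a b d) ** sym2 x y z) = (d * x - 2 * b * y + a * z) / D" for x y z
    by (simp add: m trace_mat2 add_divide_distrib diff_divide_distrib)
  show ?thesis
    by (simp only: affine_invariant_metric_def t1 t2)
qed

text \<open>The vertical space at \<open>S = sym2 a b d\<close> is spanned by \<open>S\<close> and \<open>sym2 a 0 (- d)\<close>.\<close>

lemma horizontal_cor:
  assumes \<alpha>: "\<alpha> > 0" and \<beta>: "\<beta> > - \<alpha> / 2" and S: "sym2 a b d \<in> SPD"
  shows "horizontal cor Sym (affine_invariant_metric \<alpha> \<beta>) (sym2 a b d) =
    range (\<lambda>y. sym2 (b * y / d) y (b * y / a))"
proof -
  define D where "D = a * d - b\<^sup>2"
  have pos: "a > 0" "d > 0" "D > 0"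
    using S by (auto simp: sym2_in_SPD D_def)
  note metric = affine_invariant_metric_sym2[of a d b, folded D_def]
  have vert: "differential cor (sym2 a b d) (sym2 x y z) = 0 \<longleftrightarrow> y = b * (x / a + z / d) / 2" for x y z
    using pos by (simp add: differential_cor zero_eq_mat2)
  show ?thesis
  proof (intro subset_antisym subsetI)
    fix H assume H: "H \<in> horizontal cor Sym (affine_invariant_metric \<alpha> \<beta>) (sym2 a b d)"
    then obtain x y z where h: "H = sym2 x y z"
      by (auto simp: horizontal_def Sym_2)
    have orth: "affine_invariant_metric \<alpha> \<beta> (sym2 a b d) (sym2 x y z) (sym2 x' y' z') = 0"
      if "y' = b * (x' / a + z' / d) / 2" for x' y' z'
      using H that vert[of x' y' z'] by (auto simp: horizontal_def Sym_2 h)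
    \<comment> \<open>Pairing with the base point itself gives \<open>\<alpha> + 2 * \<beta>\<close>
      times the trace of \<open>matrix_inv S ** H\<close>. The bound on \<beta> makes this factor
      positive, so horizontality forces the trace to vanish.\<close>
    have "affine_invariant_metric \<alpha> \<beta> (sym2 a b d) (sym2 x y z) (sym2 a b d) =
        (\<alpha> + 2 * \<beta>) * (d * x - 2 * b * y + a * z) / D"
    proof -
      have "(d * x - b * y) * (d * a - b * b) + (d * y - b * z) * (a * b - b * a) +
          (a * y - b * x) * (d * b - b * d) + (a * z - b * y) * (a * d - b * b)
          = D * (d * x - 2 * b * y + a * z)"
        by (simp add: D_def algebra_simps power2_eq_square)
      moreover have "d * a - 2 * b * b + a * d = 2 * D"
        by (simp add: D_def algebra_simps power2_eq_square)
      ultimately show ?thesis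
        using pos by (simp only: metric) (simp add: field_simps power2_eq_square)
    qed
    then have 1: "d * x - 2 * b * y + a * z = 0"
      using orth[of b a d] pos \<alpha> \<beta> by simp
    \<comment> \<open>The second vertical vector comes from scaling the two coordinates in opposite
      directions. It has trace zero against \<open>S\<close>, so \<beta> disappears.\<close>
    have "affine_invariant_metric \<alpha> \<beta> (sym2 a b d) (sym2 x y z) (sym2 a 0 (- d)) = \<alpha> * (d * x - a * z) / D"
    proof -
      have "(d * x - b * y) * (d * a - b * 0) + (d * y - b * z) * (a * 0 - b * a) +
          (a * y - b * x) * (d * 0 - b * (- d)) + (a * z - b * y) * (a * (- d) - b * 0)
          = D * (d * x - a * z)"
        by (simp add: D_def algebra_simps power2_eq_square)
      moreover have "d * a - 2 * b * 0 + a * (- d) = 0"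
        by simp
      ultimately show ?thesis
        using pos by (simp only: metric) (simp add: power2_eq_square)
    qed
    then have 2: "d * x = a * z"
      using orth[of 0 a "- d"] pos \<alpha> by simp
    have "x = b * y / d" "z = b * y / a"
      using 1 2 pos by (simp_all add: field_simps)
    then show "H \<in> range (\<lambda>y. sym2 (b * y / d) y (b * y / a))"
      by (auto simp: h)
  next
    fix H assume "H \<in> range (\<lambda>y. sym2 (b * y / d) y (b * y / a))"
    then obtain y where h: "H = sym2 (b * y / d) y (b * y / a)"
      by auto
    have "affine_invariant_metric \<alpha> \<beta> (sym2 a b d) H K = 0"
      if K: "K \<in> Sym" "differential cor (sym2 a b d) K = 0" for K
    proof -
      obtain x' y' z' where k: "K = sym2 x' y' z'"
        using K by (auto simp: Sym_2)
      have y': "y' = b * (x' / a + z' / d) / 2"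
        using K vert by (simp add: k)
      \<comment> \<open>These are, up to the factor \<open>D\<close>, the diagonal entries and the
        trace of \<open>matrix_inv S ** H\<close>; only its off-diagonal entries survive in the
        pairing.\<close>
      have 1: "d * (b * y / d) - b * y = 0" "a * (b * y / a) - b * y = 0"
        "d * (b * y / d) - 2 * b * y + a * (b * y / a) = 0"
        using pos by simp_all
      have 2: "d * y - b * (b * y / a) = D * y / a" "a * y - b * (b * y / d) = D * y / d"
        using pos by (simp_all add: D_def field_simps power2_eq_square)
      \<comment> \<open>After dividing by \<open>D * y\<close> when this is nonzero, what remains is
        twice the verticality condition \<open>y'\<close>.\<close>
      have "D * y / a * (a * y' - b * x') + D * y / d * (d * y' - b * z') = 0"
        using pos by (simp add: y' field_simps)
      then show ?thesis
        using pos by (simp only: h k metric 1 2) simp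
    qed
    then show "H \<in> horizontal cor Sym (affine_invariant_metric \<alpha> \<beta>) (sym2 a b d)"
      by (auto simp: horizontal_def Sym_2 h)
  qed
qed

text \<open>For horizontal \<open>H\<close> the matrix \<open>matrix_inv S ** H\<close> has zero
  diagonal and off-diagonal entries \<open>y / a\<close> and \<open>y / d\<close>. The \<beta> term
  vanishes, and the trace of the product of two such matrices is a sum of two equal terms.\<close>

lemma horizontal_cor_metric:
  assumes S: "sym2 a b d \<in> SPD"
  shows "affine_invariant_metric \<alpha> \<beta> (sym2 a b d)
    (sym2 (b * y / d) y (b * y / a)) (sym2 (b * y' / d) y' (b * y' / a)) = 2 * \<alpha> * y * y' / (a * d)"
proof -
  define D where "D = a * d - b\<^sup>2"
  have pos: "a > 0" "d > 0" "D > 0"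
    using S by (auto simp: sym2_in_SPD D_def)
  have 1: "d * (b * y / d) - b * y = 0" "a * (b * y / a) - b * y = 0"
    "d * (b * y / d) - 2 * b * y + a * (b * y / a) = 0"
    "d * y - b * (b * y / a) = D * y / a" "a * y - b * (b * y / d) = D * y / d" for y
    using pos by (simp_all add: D_def field_simps power2_eq_square)
  show ?thesis
    using pos by (simp only: affine_invariant_metric_sym2[of a d b, folded D_def] 1)
      (simp add: field_simps power2_eq_square)
qed

text \<open>Here the factor \<open>1 - r\<^sup>2\<close> of the quotient metric arises. The image
  depends on the point of the fibre only through \<open>r\<close> and
  \<open>y / (sqrt a * sqrt d)\<close>, the same normalised entry that governs the horizontal inner
  product.\<close>

lemma differential_cor_horizontal:
  assumes S: "sym2 a b d \<in> SPD"
  defines "r \<equiv> b / (sqrt a * sqrt d)"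
  shows "differential cor (sym2 a b d) (sym2 (b * y / d) y (b * y / a)) =
    offd (y / (sqrt a * sqrt d) * (1 - r\<^sup>2))"
proof -
  have pos: "a > 0" "d > 0"
    using S by (auto simp: sym2_in_SPD)
  then have "r\<^sup>2 = b\<^sup>2 / (a * d)"
    by (simp add: r_def power_divide power_mult_distrib)
  with pos have "y - b * (b * y / d / a + b * y / a / d) / 2 = y * (1 - r\<^sup>2)"
    by (simp add: field_simps power2_eq_square)
  then show ?thesis
    using pos by (simp add: differential_cor)
qed

text \<open>To determine \<open>g\<close>, one point of each fibre suffices, and \<open>C2 r\<close>
  itself is the convenient one. The converse has to check the isometry condition at every point of
  the fibre.\<close>

lemma quotient_affine_metric_iff:
  fixes g :: "real^2^2 \<Rightarrow> real^2^2 \<Rightarrow> real^2^2 \<Rightarrow> real"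
  assumes \<alpha>: "\<alpha> > 0" and \<beta>: "\<beta> > - \<alpha> / 2"
  shows "quotient_affine_metric \<alpha> \<beta> g \<longleftrightarrow>
    (\<forall>r\<in>{-1<..<1}. \<forall>x y. g (C2 r) (offd x) (offd y) = 2 * \<alpha> * (1 / (1 - r\<^sup>2))\<^sup>2 * x * y)"
    (is "_ \<longleftrightarrow> ?R")
proof
  assume "quotient_affine_metric \<alpha> \<beta> g"
  then have sub: "g (cor S) (differential cor S H) (differential cor S K) = affine_invariant_metric \<alpha> \<beta> S H K"
    if "S \<in> SPD" "H \<in> horizontal cor Sym (affine_invariant_metric \<alpha> \<beta>) S"
      "K \<in> horizontal cor Sym (affine_invariant_metric \<alpha> \<beta>) S" for S H K
    using that by (simp add: quotient_affine_metric_def riemannian_submersion_def)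
  show ?R
  proof (intro ballI allI)
    fix r x y :: real assume r: "r \<in> {-1<..<1}"
    then have S: "sym2 1 r 1 \<in> SPD"
      using C2_in_Cor[of r] by (simp add: Cor_def C2_eq_mat2)
    have nz: "1 - r\<^sup>2 > 0"
      using S by (simp add: sym2_in_SPD)
    \<comment> \<open>Division by \<open>1 - r\<^sup>2\<close> undoes the contraction by the
      differential of \<open>cor\<close>, so \<open>?H x\<close> is the horizontal lift of
      \<open>offd x\<close>.\<close>
    let ?h = "\<lambda>x. x / (1 - r\<^sup>2)"
    let ?H = "\<lambda>x. sym2 (r * ?h x / 1) (?h x) (r * ?h x / 1)"
    have hor: "?H x \<in> horizontal cor Sym (affine_invariant_metric \<alpha> \<beta>) (sym2 1 r 1)" for x
      unfolding horizontal_cor[OF \<alpha> \<beta> S] by (rule rangeI)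
    have d: "differential cor (sym2 1 r 1) (?H x) = offd x" for x
      unfolding differential_cor_horizontal[OF S] using nz by simp
    have c: "cor (sym2 1 r 1) = C2 r"
      by (simp add: cor_sym2)
    show "g (C2 r) (offd x) (offd y) = 2 * \<alpha> * (1 / (1 - r\<^sup>2))\<^sup>2 * x * y"
      using sub[OF S hor hor, of x y, unfolded d c horizontal_cor_metric[OF S]]
      by (simp add: power2_eq_square)
  qed
next
  assume g: ?R
  have "cor differentiable (at S within SPD) \<and>
      differential cor S ` Sym = Hol \<and>
      (\<forall>H\<in>horizontal cor Sym (affine_invariant_metric \<alpha> \<beta>) S.
       \<forall>K\<in>horizontal cor Sym (affine_invariant_metric \<alpha> \<beta>) S.
         g (cor S) (differential cor S H) (differential cor S K) = affine_invariant_metric \<alpha> \<beta> S H K)"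
    if SPD: "S \<in> SPD" for S
  proof (intro conjI ballI)
    show "cor differentiable (at S within SPD)"
      using SPD by (rule cor_differentiable)
    obtain a b d where S: "S = sym2 a b d"
      using SPD by (auto simp: SPD_def Sym_2)
    note SPD' = SPD[unfolded S]
    have pos: "a > 0" "d > 0" "a * d - b\<^sup>2 > 0"
      using SPD' by (auto simp: sym2_in_SPD)
    show "differential cor S ` Sym = Hol"
    proof (intro subset_antisym subsetI)
      fix X assume "X \<in> differential cor S ` Sym"
      then show "X \<in> Hol"
        using pos by (auto simp: S Sym_2 Hol_2 differential_cor)
    next
      fix X :: "real^2^2" assume "X \<in> Hol"
      then obtain x where "X = offd x"
        by (auto simp: Hol_2)
      then have "X = differential cor S (sym2 0 (x * (sqrt a * sqrt d)) 0)"
        using pos by (simp add: S differential_cor)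
      then show "X \<in> differential cor S ` Sym"
        by (auto simp: Sym_2)
    qed
    fix H K
    assume "H \<in> horizontal cor Sym (affine_invariant_metric \<alpha> \<beta>) S"
      and "K \<in> horizontal cor Sym (affine_invariant_metric \<alpha> \<beta>) S"
    then obtain y y' where H: "H = sym2 (b * y / d) y (b * y / a)" and K: "K = sym2 (b * y' / d) y' (b * y' / a)"
      using horizontal_cor[OF \<alpha> \<beta> SPD'] by (auto simp: S)
    define r where "r = b / (sqrt a * sqrt d)"
    have r: "r \<in> {-1<..<1}"
      using cor_coord_in pos by (simp add: r_def)
    then have "1 - r\<^sup>2 > 0"
      by (simp add: abs_square_less_1 abs_less_iff)
    moreover have "cor S = C2 r"
      using pos by (simp add: S cor_sym2 r_def)
    moreover have "sqrt a * sqrt d * (sqrt a * sqrt d) = a * d"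
      using pos by (simp flip: real_sqrt_mult)
    ultimately show "g (cor S) (differential cor S H) (differential cor S K) = affine_invariant_metric \<alpha> \<beta> S H K"
      using g[rule_format, OF r] pos
      by (simp only: S H K horizontal_cor_metric[OF SPD'] differential_cor_horizontal[OF SPD', folded r_def])
        (simp add: power2_eq_square)
  qed
  then show "quotient_affine_metric \<alpha> \<beta> g"
    using \<alpha> \<beta> by (simp add: quotient_affine_metric_def riemannian_submersion_def cor_image_SPD)
qed

subsection \<open>Geodesics\<close>

lemma tanh_artanh_real: "tanh (artanh r) = r" if "r \<in> {-1<..<1}" for r :: real
proof -
  have "artanh r = ln (sqrt ((1 + r) / (1 - r)))"
    using that by (simp add: artanh_def ln_sqrt)
  then have "tanh (artanh r) = ((1 + r) / (1 - r) - 1) / ((1 + r) / (1 - r) + 1)"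
    using that by (simp add: tanh_ln_real)
  also have "\<dots> = r"
    using that by (simp add: field_simps)
  finally show ?thesis .
qed

text \<open>Writing \<open>sinh ?p\<close> as \<open>r * cosh ?p\<close> in the addition formulas
  leaves the common factor \<open>cosh ?p\<close>, which cancels. This turns an affine function of
  \<open>artanh\<close> into the closed form of the geodesic.\<close>

lemma tanh_artanh_add:
  fixes r u :: real
  assumes "r \<in> {-1<..<1}"
  shows "tanh (artanh r + u) = (r * cosh u + sinh u) / (r * sinh u + cosh u)"
proof -
  let ?p = "artanh r"
  have "sinh ?p = r * cosh ?p"
    using tanh_artanh_real[OF assms] by (simp add: tanh_def field_simps)
  then have "tanh (?p + u) = (cosh ?p * (r * cosh u + sinh u)) / (cosh ?p * (r * sinh u + cosh u))"
    by (simp add: tanh_def sinh_add cosh_add algebra_simps)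
  then show ?thesis by simp
qed

lemma hyperbolic_geodesic_iff:
  assumes g: "\<And>r x y. r \<in> {-1<..<1} \<Longrightarrow> g (C2 r) (offd x) (offd y) = k * (1 / (1 - r\<^sup>2))\<^sup>2 * x * y"
    and k: "k > 0" and r: "r\<^sub>1 \<in> {-1<..<1}" "r\<^sub>2 \<in> {-1<..<1}"
  defines "l \<equiv> ln (sqrt ((1 + r\<^sub>2) / (1 - r\<^sub>2))) - ln (sqrt ((1 + r\<^sub>1) / (1 - r\<^sub>1)))"
  shows "geodesic Cor Hol g \<gamma> \<and> \<gamma> 0 = C2 r\<^sub>1 \<and> \<gamma> 1 = C2 r\<^sub>2 \<longleftrightarrow>
    (\<forall>t. \<gamma> t = C2 ((r\<^sub>1 * cosh (l * t) + sinh (l * t)) / (r\<^sub>1 * sinh (l * t) + cosh (l * t))))"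
proof -
  have l: "l = artanh r\<^sub>2 - artanh r\<^sub>1"
    using r by (simp add: l_def artanh_def ln_sqrt)
  have "tanh ((1 - t) * artanh r\<^sub>1 + t * artanh r\<^sub>2) =
      (r\<^sub>1 * cosh (l * t) + sinh (l * t)) / (r\<^sub>1 * sinh (l * t) + cosh (l * t))" for t
  proof -
    have "(1 - t) * artanh r\<^sub>1 + t * artanh r\<^sub>2 = artanh r\<^sub>1 + l * t"
      by (simp add: l algebra_simps)
    then show ?thesis
      by (simp only: tanh_artanh_add[OF r(1)])
  qed
  moreover have "geodesic Cor Hol g \<gamma> \<and> \<gamma> 0 = C2 r\<^sub>1 \<and> \<gamma> 1 = C2 r\<^sub>2 \<longleftrightarrow>
    (\<forall>t. \<gamma> t = C2 (tanh ((1 - t) * artanh r\<^sub>1 + t * artanh r\<^sub>2)))"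
  proof (rule geodesic_C2_iff[where \<phi>' = "\<lambda>r. 1 / (1 - r\<^sup>2)" and \<phi>'' = "\<lambda>r. 2 * r / (1 - r\<^sup>2)\<^sup>2",
        OF g k _ _ _ _ _ _ _ r])
    fix r :: real assume r: "r \<in> {-1<..<1}"
    show "(artanh has_real_derivative 1 / (1 - r\<^sup>2)) (at r)"
      using r by (intro artanh_real_has_field_derivative) auto
    show "((\<lambda>r. 1 / (1 - r\<^sup>2)) has_real_derivative 2 * r / (1 - r\<^sup>2)\<^sup>2) (at r)"
      using one_minus_square_pos[OF r] by (auto intro!: derivative_eq_intros simp: power2_eq_square)
    show "1 / (1 - r\<^sup>2) \<noteq> 0"
      using one_minus_square_pos[OF r] by simp
    show "tanh (artanh r) = r"
      using r by (rule tanh_artanh_real)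
  next
    fix u :: real
    show "(tanh has_real_derivative 1 / (1 / (1 - (tanh u)\<^sup>2))) (at u)"
      by (auto intro!: derivative_eq_intros)
  qed (auto simp: artanh_tanh_real tanh_real_gt_neg1 tanh_real_lt_1)
  ultimately show ?thesis by simp
qed

text \<open>The two coordinates are the sine \<open>r\<close> and the tangent \<open>u\<close> of
  one angle, whose cosine is both \<open>sqrt (1 - r\<^sup>2)\<close> and
  \<open>1 / sqrt (1 + u\<^sup>2)\<close>.\<close>

lemma cholesky_coord_bij:
  fixes r u :: real
  shows "u / sqrt (1 + u\<^sup>2) \<in> {-1<..<1}"
    and "sqrt (1 - (u / sqrt (1 + u\<^sup>2))\<^sup>2) = 1 / sqrt (1 + u\<^sup>2)"
    and "r \<in> {-1<..<1} \<Longrightarrow> (r / sqrt (1 - r\<^sup>2)) / sqrt (1 + (r / sqrt (1 - r\<^sup>2))\<^sup>2) = r"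
proof -
  have pos: "1 + u\<^sup>2 > 0"
    by (intro add_pos_nonneg) auto
  then have e: "1 - (u / sqrt (1 + u\<^sup>2))\<^sup>2 = 1 / (1 + u\<^sup>2)"
    by (simp add: power_divide field_simps)
  with pos have "(u / sqrt (1 + u\<^sup>2))\<^sup>2 < 1"
    by (metis diff_gt_0_iff_gt divide_pos_pos zero_less_one)
  then show "u / sqrt (1 + u\<^sup>2) \<in> {-1<..<1}"
    unfolding abs_square_less_1 abs_less_iff greaterThanLessThan_iff by linarith
  show "sqrt (1 - (u / sqrt (1 + u\<^sup>2))\<^sup>2) = 1 / sqrt (1 + u\<^sup>2)"
    by (simp only: e real_sqrt_divide real_sqrt_one)
  assume "r \<in> {-1<..<1}"
  then have s: "1 - r\<^sup>2 > 0"
    by (rule one_minus_square_pos)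
  then have "1 + (r / sqrt (1 - r\<^sup>2))\<^sup>2 = 1 / (1 - r\<^sup>2)"
    by (simp add: power_divide field_simps)
  with s show "(r / sqrt (1 - r\<^sup>2)) / sqrt (1 + (r / sqrt (1 - r\<^sup>2))\<^sup>2) = r"
    by (simp add: real_sqrt_divide)
qed

lemma cholesky_geodesic_iff:
  assumes g: "\<And>r x y. r \<in> {-1<..<1} \<Longrightarrow> g (C2 r) (offd x) (offd y) = k * (1 / sqrt (1 - r\<^sup>2) ^ 3)\<^sup>2 * x * y"
    and k: "k > 0" and r: "r\<^sub>1 \<in> {-1<..<1}" "r\<^sub>2 \<in> {-1<..<1}"
  defines "F \<equiv> \<lambda>t. (1 - t) * (r\<^sub>1 / sqrt (1 - r\<^sub>1\<^sup>2)) + t * (r\<^sub>2 / sqrt (1 - r\<^sub>2\<^sup>2))"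
  shows "geodesic Cor Hol g \<gamma> \<and> \<gamma> 0 = C2 r\<^sub>1 \<and> \<gamma> 1 = C2 r\<^sub>2 \<longleftrightarrow>
    (\<forall>t. \<gamma> t = C2 (F t / sqrt (1 + (F t)\<^sup>2)))"
  unfolding F_def
proof (rule geodesic_C2_iff[where \<phi> = "\<lambda>r. r / sqrt (1 - r\<^sup>2)" and \<psi> = "\<lambda>u. u / sqrt (1 + u\<^sup>2)"
      and \<phi>' = "\<lambda>r. 1 / sqrt (1 - r\<^sup>2) ^ 3" and \<phi>'' = "\<lambda>r. 3 * r / sqrt (1 - r\<^sup>2) ^ 5",
      OF g k cholesky_coord_has_derivative _ _ cholesky_coord_bij(1) _ cholesky_coord_bij(3) _ r])
  fix r :: real assume r: "r \<in> {-1<..<1}"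
  define s where "s = sqrt (1 - r\<^sup>2)"
  have s: "s > 0"
    using one_minus_square_pos[OF r] by (simp add: s_def)
  have "((\<lambda>r. sqrt (1 - r\<^sup>2)) has_real_derivative - r / s) (at r)"
    using one_minus_square_pos[OF r] by (auto intro!: derivative_eq_intros simp: s_def divide_simps)
  from DERIV_divide[OF DERIV_const[of 1] DERIV_power[OF this, of 3], folded s_def]
  have "((\<lambda>r. 1 / sqrt (1 - r\<^sup>2) ^ 3) has_real_derivative 3 * r / s ^ 5) (at r)"
    by (rule DERIV_cong) (use s in \<open>simp_all add: field_simps eval_nat_numeral\<close>)
  then show "((\<lambda>r. 1 / sqrt (1 - r\<^sup>2) ^ 3) has_real_derivative 3 * r / sqrt (1 - r\<^sup>2) ^ 5) (at r)"
    by (simp add: s_def)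
  show "1 / sqrt (1 - r\<^sup>2) ^ 3 \<noteq> 0"
    using s by (simp add: s_def)
next
  fix u :: real
  have pos: "1 + u\<^sup>2 > 0"
    by (intro add_pos_nonneg) auto
  show "u / sqrt (1 + u\<^sup>2) / sqrt (1 - (u / sqrt (1 + u\<^sup>2))\<^sup>2) = u"
    unfolding cholesky_coord_bij(2) using pos by simp
  define s where "s = sqrt (1 + u\<^sup>2)"
  have s: "s > 0" "u * u = s * s - 1"
    using pos by (simp_all add: s_def power2_eq_square)
  have "((\<lambda>u. sqrt (1 + u\<^sup>2)) has_real_derivative u / s) (at u)"
    using pos by (auto intro!: derivative_eq_intros simp: s_def divide_simps)
  from DERIV_divide[OF DERIV_ident this, folded s_def]
  have "((\<lambda>u. u / sqrt (1 + u\<^sup>2)) has_real_derivative (s - u * u / s) / (s * s)) (at u)"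
    using s(1) by simp
  \<comment> \<open>The nested reciprocals are \<open>1 / \<phi>' (\<psi> u)\<close>, with the
    square root in \<phi>' rewritten as \<open>1 / s\<close>.\<close>
  also have "(s - u * u / s) / (s * s) = 1 / (1 / (1 / s) ^ 3)"
    unfolding s(2) using s(1) by (simp add: field_simps eval_nat_numeral)
  finally show "((\<lambda>u. u / sqrt (1 + u\<^sup>2)) has_real_derivative
      1 / (1 / sqrt (1 - (u / sqrt (1 + u\<^sup>2))\<^sup>2) ^ 3)) (at u)"
    unfolding cholesky_coord_bij(2) s_def .
qed

section \<open>The Lie-Cholesky group geodesic\<close>

lemma inj_on_Theta: "inj_on Theta Cor"
proof (rule inj_onI)
  fix A B :: "real^2^2" assume "A \<in> Cor" "B \<in> Cor" and eq: "Theta A = Theta B"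
  then obtain q r where q: "q \<in> {-1<..<1}" "A = C2 q" and r: "r \<in> {-1<..<1}" "B = C2 r"
    by (auto simp: Cor_2)
  have "q / sqrt (1 - q\<^sup>2) = r / sqrt (1 - r\<^sup>2)"
    using eq unfolding q(2) r(2) Theta_C2[OF q(1)] Theta_C2[OF r(1)] by simp
  then have "q = r"
    using cholesky_coord_bij(3) q(1) r(1) by metis
  then show "A = B"
    by (simp add: q r)
qed

text \<open>The subdiagonal entry is an isomorphism from the unipotent group to the additive reals,
  under which exponential and logarithm become the identity. The group geodesic is thus
  \<open>f\<^sub>1 + t * (f\<^sub>2 - f\<^sub>1)\<close>, which is \<open>F t\<close>.\<close>

lemma lie_cholesky_geodesic_C2:
  assumes r: "r\<^sub>1 \<in> {-1<..<1}" "r\<^sub>2 \<in> {-1<..<1}"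
  defines "F \<equiv> \<lambda>t. (1 - t) * (r\<^sub>1 / sqrt (1 - r\<^sub>1\<^sup>2)) + t * (r\<^sub>2 / sqrt (1 - r\<^sub>2\<^sup>2))"
  shows "lie_cholesky_geodesic (C2 r\<^sub>1) (C2 r\<^sub>2) t = C2 (F t / sqrt (1 + (F t)\<^sup>2))"
proof -
  define f\<^sub>1 where "f\<^sub>1 = r\<^sub>1 / sqrt (1 - r\<^sub>1\<^sup>2)"
  define f\<^sub>2 where "f\<^sub>2 = r\<^sub>2 / sqrt (1 - r\<^sub>2\<^sup>2)"
  have "Theta (C2 r\<^sub>1) ** mexp (t *\<^sub>R mlog (matrix_inv (Theta (C2 r\<^sub>1)) ** Theta (C2 r\<^sub>2))) = mat2 1 0 (F t) 1"
    by (simp add: Theta_C2[OF r(1)] Theta_C2[OF r(2)] matrix_inv_mat2 mat2_mult mlog_mat2 mat2_scaleR mexp_LT0 F_def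
        flip: f\<^sub>1_def f\<^sub>2_def) (simp add: algebra_simps)
  also have "\<dots> = Theta (C2 (F t / sqrt (1 + (F t)\<^sup>2)))"
    unfolding Theta_C2[OF cholesky_coord_bij(1)] cholesky_coord_bij(2)
    using add_pos_nonneg[of 1 "(F t)\<^sup>2"] by simp
  finally show ?thesis
    unfolding lie_cholesky_geodesic_def
    using the_inv_into_f_f[OF inj_on_Theta] cholesky_coord_bij(1) by (simp add: C2_in_Cor)
qed

lemma metric_eq_on_Cor_Hol_2:
  "metric_eq_on Cor Hol g h \<longleftrightarrow>
    (\<forall>r\<in>{-1<..<1}. \<forall>x y. g (C2 r) (offd x) (offd y) = h (C2 r) (offd x) (offd y))"
  by (simp add: metric_eq_on_def Cor_2 Hol_2)

theorem theorem4p9: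
  fixes \<rho>\<^sub>1 \<rho>\<^sub>2 :: real
  assumes "\<rho>\<^sub>1 \<in> {-1<..<1}" and "\<rho>\<^sub>2 \<in> {-1<..<1}"
  shows
    "(\<exists>c>0. \<forall>\<alpha> \<beta> g. \<alpha> > 0 \<longrightarrow> \<beta> > - \<alpha> / 2 \<longrightarrow>
        (quotient_affine_metric \<alpha> \<beta> g \<longleftrightarrow>
         metric_eq_on Cor Hol g (poly_hyperbolic_cholesky_metric (c * \<alpha>))))
     \<and>
     (let l = ln (sqrt ((1 + \<rho>\<^sub>2) / (1 - \<rho>\<^sub>2))) - ln (sqrt ((1 + \<rho>\<^sub>1) / (1 - \<rho>\<^sub>1)));
          \<rho> = (\<lambda>t. (\<rho>\<^sub>1 * cosh (l * t) + sinh (l * t)) / (\<rho>\<^sub>1 * sinh (l * t) + cosh (l * t)))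
      in (\<forall>\<alpha> \<beta> g \<gamma>. quotient_affine_metric \<alpha> \<beta> g \<longrightarrow>
            (geodesic Cor Hol g \<gamma> \<and> \<gamma> 0 = C2 \<rho>\<^sub>1 \<and> \<gamma> 1 = C2 \<rho>\<^sub>2
             \<longleftrightarrow> (\<forall>t. \<gamma> t = C2 (\<rho> t)))) \<and>
         (\<forall>\<alpha>\<^sub>1 \<gamma>. \<alpha>\<^sub>1 > 0 \<longrightarrow>
            (geodesic Cor Hol (poly_hyperbolic_cholesky_metric \<alpha>\<^sub>1) \<gamma>
               \<and> \<gamma> 0 = C2 \<rho>\<^sub>1 \<and> \<gamma> 1 = C2 \<rho>\<^sub>2
             \<longleftrightarrow> (\<forall>t. \<gamma> t = C2 (\<rho> t)))))
     \<and>
     (\<forall>b. inner_product_on LT0 b \<longrightarrow>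
        metric_eq_on Cor Hol (euclidean_cholesky_metric b) (log_euclidean_cholesky_metric b))
     \<and>
     (let F = (\<lambda>t. (1 - t) * (\<rho>\<^sub>1 / sqrt (1 - \<rho>\<^sub>1\<^sup>2)) + t * (\<rho>\<^sub>2 / sqrt (1 - \<rho>\<^sub>2\<^sup>2)));
          \<rho> = (\<lambda>t. F t / sqrt (1 + (F t)\<^sup>2))
      in (\<forall>b \<gamma>. inner_product_on LT0 b \<longrightarrow>
            (geodesic Cor Hol (euclidean_cholesky_metric b) \<gamma> \<and> \<gamma> 0 = C2 \<rho>\<^sub>1 \<and> \<gamma> 1 = C2 \<rho>\<^sub>2
             \<longleftrightarrow> (\<forall>t. \<gamma> t = C2 (\<rho> t))) \<and>
            (geodesic Cor Hol (log_euclidean_cholesky_metric b) \<gamma> \<and> \<gamma> 0 = C2 \<rho>\<^sub>1 \<and> \<gamma> 1 = C2 \<rho>\<^sub>2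
             \<longleftrightarrow> (\<forall>t. \<gamma> t = C2 (\<rho> t)))) \<and>
         (\<forall>t. lie_cholesky_geodesic (C2 \<rho>\<^sub>1) (C2 \<rho>\<^sub>2) t = C2 (\<rho> t)))"
proof (intro conjI)
  \<comment> \<open>Both metrics have the coefficient \<open>(1 / (1 - r\<^sup>2))\<^sup>2\<close>,
    with prefactors \<open>2 * \<alpha>\<close> and \<open>\<alpha>\<^sub>1\<close>; hence the scale
    \<open>c = 2\<close>.\<close>
  have qa: "quotient_affine_metric \<alpha> \<beta> g \<longleftrightarrow> metric_eq_on Cor Hol g (poly_hyperbolic_cholesky_metric (2 * \<alpha>))"
    if "\<alpha> > 0" "\<beta> > - \<alpha> / 2" for \<alpha> \<beta> and g :: "real^2^2 \<Rightarrow> real^2^2 \<Rightarrow> real^2^2 \<Rightarrow> real"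
    unfolding quotient_affine_metric_iff[OF that] metric_eq_on_Cor_Hol_2
    by (simp only: poly_hyperbolic_cholesky_metric_C2 cong: ball_cong)
  then show "\<exists>c>0. \<forall>\<alpha> \<beta> g. \<alpha> > 0 \<longrightarrow> \<beta> > - \<alpha> / 2 \<longrightarrow>
      (quotient_affine_metric \<alpha> \<beta> g \<longleftrightarrow>
       metric_eq_on Cor Hol g (poly_hyperbolic_cholesky_metric (c * \<alpha>)))"
    by (intro exI[of _ 2]) simp
  let ?l = "ln (sqrt ((1 + \<rho>\<^sub>2) / (1 - \<rho>\<^sub>2))) - ln (sqrt ((1 + \<rho>\<^sub>1) / (1 - \<rho>\<^sub>1)))"
  show "let l = ln (sqrt ((1 + \<rho>\<^sub>2) / (1 - \<rho>\<^sub>2))) - ln (sqrt ((1 + \<rho>\<^sub>1) / (1 - \<rho>\<^sub>1)));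
          \<rho> = (\<lambda>t. (\<rho>\<^sub>1 * cosh (l * t) + sinh (l * t)) / (\<rho>\<^sub>1 * sinh (l * t) + cosh (l * t)))
      in (\<forall>\<alpha> \<beta> g \<gamma>. quotient_affine_metric \<alpha> \<beta> g \<longrightarrow>
            (geodesic Cor Hol g \<gamma> \<and> \<gamma> 0 = C2 \<rho>\<^sub>1 \<and> \<gamma> 1 = C2 \<rho>\<^sub>2
             \<longleftrightarrow> (\<forall>t. \<gamma> t = C2 (\<rho> t)))) \<and>
         (\<forall>\<alpha>\<^sub>1 \<gamma>. \<alpha>\<^sub>1 > 0 \<longrightarrow>
            (geodesic Cor Hol (poly_hyperbolic_cholesky_metric \<alpha>\<^sub>1) \<gamma>
               \<and> \<gamma> 0 = C2 \<rho>\<^sub>1 \<and> \<gamma> 1 = C2 \<rho>\<^sub>2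
             \<longleftrightarrow> (\<forall>t. \<gamma> t = C2 (\<rho> t))))"
    unfolding Let_def
  proof (intro conjI allI impI)
    fix \<alpha> \<beta> \<gamma> and g :: "real^2^2 \<Rightarrow> real^2^2 \<Rightarrow> real^2^2 \<Rightarrow> real"
    assume g: "quotient_affine_metric \<alpha> \<beta> g"
    then have ab: "\<alpha> > 0" "\<beta> > - \<alpha> / 2"
      by (simp_all add: quotient_affine_metric_def)
    show "geodesic Cor Hol g \<gamma> \<and> \<gamma> 0 = C2 \<rho>\<^sub>1 \<and> \<gamma> 1 = C2 \<rho>\<^sub>2 \<longleftrightarrow> (\<forall>t. \<gamma> t = C2 ((\<rho>\<^sub>1 * cosh (?l * t) + sinh (?l * t)) / (\<rho>\<^sub>1 * sinh (?l * t) + cosh (?l * t))))"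
      by (rule hyperbolic_geodesic_iff[OF _ _ assms, where k = "2 * \<alpha>"])
        (use g ab in \<open>simp_all add: quotient_affine_metric_iff\<close>)
  next
    fix \<alpha>\<^sub>1 :: real and \<gamma> assume "\<alpha>\<^sub>1 > 0"
    then show "geodesic Cor Hol (poly_hyperbolic_cholesky_metric \<alpha>\<^sub>1) \<gamma> \<and> \<gamma> 0 = C2 \<rho>\<^sub>1 \<and> \<gamma> 1 = C2 \<rho>\<^sub>2
        \<longleftrightarrow> (\<forall>t. \<gamma> t = C2 ((\<rho>\<^sub>1 * cosh (?l * t) + sinh (?l * t)) / (\<rho>\<^sub>1 * sinh (?l * t) + cosh (?l * t))))"
      by (intro hyperbolic_geodesic_iff[OF poly_hyperbolic_cholesky_metric_C2 _ assms])
  qed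
  show "\<forall>b. inner_product_on LT0 b \<longrightarrow>
      metric_eq_on Cor Hol (euclidean_cholesky_metric b) (log_euclidean_cholesky_metric b)"
    by (simp add: metric_eq_on_Cor_Hol_2 cholesky_metrics_C2)
  \<comment> \<open>The blocks export the equivalences for arbitrary \<open>b\<close>; the constant
    \<open>k\<close> is the squared length of the spanning vector of \<open>LT0\<close>.\<close>
  {
    fix b :: "real^2^2 \<Rightarrow> real^2^2 \<Rightarrow> real" assume b: "inner_product_on LT0 b"
    note cholesky_geodesic_iff[OF cholesky_metrics_C2(1)[OF b] cholesky_metrics_C2(3)[OF b assms(1)] assms]
  }
  note euc = this
  {
    fix b :: "real^2^2 \<Rightarrow> real^2^2 \<Rightarrow> real" assume b: "inner_product_on LT0 b"
    note cholesky_geodesic_iff[OF cholesky_metrics_C2(2)[OF b] cholesky_metrics_C2(3)[OF b assms(1)] assms]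
  }
  note log_euc = this
  show "let F = (\<lambda>t. (1 - t) * (\<rho>\<^sub>1 / sqrt (1 - \<rho>\<^sub>1\<^sup>2)) + t * (\<rho>\<^sub>2 / sqrt (1 - \<rho>\<^sub>2\<^sup>2)));
          \<rho> = (\<lambda>t. F t / sqrt (1 + (F t)\<^sup>2))
      in (\<forall>b \<gamma>. inner_product_on LT0 b \<longrightarrow>
            (geodesic Cor Hol (euclidean_cholesky_metric b) \<gamma> \<and> \<gamma> 0 = C2 \<rho>\<^sub>1 \<and> \<gamma> 1 = C2 \<rho>\<^sub>2
             \<longleftrightarrow> (\<forall>t. \<gamma> t = C2 (\<rho> t))) \<and>
            (geodesic Cor Hol (log_euclidean_cholesky_metric b) \<gamma> \<and> \<gamma> 0 = C2 \<rho>\<^sub>1 \<and> \<gamma> 1 = C2 \<rho>\<^sub>2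
             \<longleftrightarrow> (\<forall>t. \<gamma> t = C2 (\<rho> t)))) \<and>
         (\<forall>t. lie_cholesky_geodesic (C2 \<rho>\<^sub>1) (C2 \<rho>\<^sub>2) t = C2 (\<rho> t))"
    unfolding Let_def
    by (intro conjI allI impI euc log_euc lie_cholesky_geodesic_C2 assms)
qed

end
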